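(* Let $U$ be an irreducible almost upper-triangular transition matrix on $\mathbb N$ and let $Y=(Y_i,i\ge0)$ be a Markov chain with transition matrix $U$. For integers $0\le a<x<b$ set $$\overleftarrow{u}_{a,\ge b}(x;z)=\mathbb E\big[z^{\tau_{\{a\}}(Y)}\mathbf 1_{\tau_{\{a\}}(Y)<\tau_{[b,+\infty)}(Y)}\,\big|\,Y_0=x\big].$$ Then $$\overleftarrow{u}_{a,\ge b}(x;z)=\frac{\det(\mathrm{Id}-zU_{[x+1,b-1]})}{\det(\mathrm{Id}-zU_{[a+1,b-1]})}\prod_{j=a+1}^{x}(zU_{j,j-1}).$$ In particular, when $U$ is recurrent, for every $x\geq 1$, $\overleftarrow{u}_{0,\ge b}(x;z)$ converges as $b\to+\infty$ to $\mathbb E[z^{\tau_{\{0\}}(Y)}\mid Y_0=x]$; otherwise it converges to $$\overleftarrow{u}(x;z)=\mathbb E\big[z^{\tau_{\{0\}}(Y)}\mathbf 1_{\tau_{\{0\}}(Y)<+\infty}\,\big|\,Y_0=x\big].$$ Here convergence means that for every $k$ the coefficient of $z^k$ converges, and also that, as power series in $z$, the convergence is uniform on each compact set included in $[0,1)$.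
   Context: $\mathbb N=\{0,1,2,\dots\}$. A transition matrix $U=[U_{i,j}]_{i,j\ge0}$ on $\mathbb N$ (non-negative entries, rows summing to $1$) is almost upper-triangular if $U_{i,j}>0\Rightarrow j\ge i-1$. $\tau_S(Y)=\inf\{j>0:Y_j\in S\}$. $U_{[a,b]}=[U_{i,j}]_{a\le i,j\le b}$, $\mathrm{Id}$ is the identity matrix of the appropriate size, and the determinant of an empty matrix is $1$. The generating functions are power series in $z$. *)

theory Defs
  imports "HOL-Probability.Probability"
    "HOL-Computational_Algebra.Formal_Power_Series"
    "Jordan_Normal_Form.Determinant"
begin

definition transition_matrix :: "(nat \<Rightarrow> nat \<Rightarrow> real) \<Rightarrow> bool" where
  "transition_matrix U \<longleftrightarrow> (\<forall>i j. 0 \<le> U i j) \<and> (\<forall>i. U i sums 1)"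

definition almost_upper_triangular :: "(nat \<Rightarrow> nat \<Rightarrow> real) \<Rightarrow> bool" where
  "almost_upper_triangular U \<longleftrightarrow> (\<forall>i j. U i j > 0 \<longrightarrow> int j \<ge> int i - 1)"

primrec matrix_power :: "(nat \<Rightarrow> nat \<Rightarrow> real) \<Rightarrow> nat \<Rightarrow> nat \<Rightarrow> nat \<Rightarrow> real" where
  "matrix_power U 0 = (\<lambda>i j. of_bool (i = j))"
| "matrix_power U (Suc n) = (\<lambda>i j. \<Sum>k. U i k * matrix_power U n k j)"

definition irreducible_matrix :: "(nat \<Rightarrow> nat \<Rightarrow> real) \<Rightarrow> bool" where
  "irreducible_matrix U \<longleftrightarrow> (\<forall>i j. \<exists>n. matrix_power U n i j > 0)"

text \<open>The initial distribution of the chain is arbitrary.\<close>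

definition markov_chain ::
    "'a measure \<Rightarrow> (nat \<Rightarrow> 'a \<Rightarrow> nat) \<Rightarrow> (nat \<Rightarrow> nat \<Rightarrow> real) \<Rightarrow> bool" where
  "markov_chain M Y U \<longleftrightarrow>
     prob_space M \<and>
     (\<forall>n. Y n \<in> measurable M (count_space UNIV)) \<and>
     (\<forall>n p j. \<P>(\<omega> in M. \<forall>k\<le>n. Y k \<omega> = p k) > 0 \<longrightarrow>
        \<P>(\<omega> in M. Y (Suc n) \<omega> = j \<bar> \<forall>k\<le>n. Y k \<omega> = p k) = U (p n) j)"

text \<open>The infimum of the empty set is \<open>\<infinity>\<close>, so a set that is never hit has hitting time \<open>\<infinity>\<close>.\<close>

definition hit_time :: "nat set \<Rightarrow> (nat \<Rightarrow> nat) \<Rightarrow> enat" where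
  "hit_time S y = Inf (enat ` {j. j > 0 \<and> y j \<in> S})"

text \<open>
  Recurrence is a property of \<open>U\<close> alone: every state \<open>i\<close> is almost surely revisited by the chain
  started at \<open>i\<close>. The law \<open>N\<close> of that chain on the space of trajectories exists and is
  uniquely determined by \<open>U\<close> and \<open>i\<close>, so the quantifier over \<open>N\<close> ranges over exactly one measure.
\<close>

definition recurrent :: "(nat \<Rightarrow> nat \<Rightarrow> real) \<Rightarrow> bool" where
  "recurrent U \<longleftrightarrow>
     (\<forall>i (N :: (nat \<Rightarrow> nat) measure).
        sets N = sets (PiM UNIV (\<lambda>_. count_space UNIV)) \<longrightarrow>
        markov_chain N (\<lambda>n \<omega>. \<omega> n) U \<longrightarrow>
        (AE \<omega> in N. \<omega> 0 = i) \<longrightarrow>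
        (AE \<omega> in N. hit_time {i} \<omega> < \<infinity>))"

text \<open>The conditional probability given \<open>Y\<^sub>0 = x\<close>, meaningful when \<open>Y\<^sub>0 = x\<close> has positive probability.\<close>

definition given_start :: "'a measure \<Rightarrow> (nat \<Rightarrow> 'a \<Rightarrow> nat) \<Rightarrow> nat \<Rightarrow> 'a measure" where
  "given_start M Y x = uniform_measure M {\<omega> \<in> space M. Y 0 \<omega> = x}"

text \<open>Expectation of a random formal power series, taken coefficient by coefficient.\<close>

definition fps_expectation :: "'a measure \<Rightarrow> ('a \<Rightarrow> real fps) \<Rightarrow> real fps" where
  "fps_expectation M F = Abs_fps (\<lambda>k. LINT \<omega>|M. fps_nth (F \<omega>) k)"

text \<open>
  Each generating function comes in two versions: as a formal power series, where \<open>z\<close> is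
  the indeterminate \<open>fps_X\<close>, and as a function of a real number \<open>z\<close>.

  The value \<open>the_enat \<infinity>\<close> is unspecified. In the first two pairs the indicator cancels
  it; in the third pair the exponent is meaningful only if the hitting time of \<open>0\<close> is almost surely finite.
\<close>

definition u_left_fps ::
    "'a measure \<Rightarrow> (nat \<Rightarrow> 'a \<Rightarrow> nat) \<Rightarrow> nat \<Rightarrow> nat \<Rightarrow> nat \<Rightarrow> real fps" where
  "u_left_fps M Y a b x = fps_expectation (given_start M Y x)
     (\<lambda>\<omega>. fps_X ^ the_enat (hit_time {a} (\<lambda>n. Y n \<omega>)) *
           of_bool (hit_time {a} (\<lambda>n. Y n \<omega>) < hit_time {b..} (\<lambda>n. Y n \<omega>)))"

definition u_left ::
    "'a measure \<Rightarrow> (nat \<Rightarrow> 'a \<Rightarrow> nat) \<Rightarrow> nat \<Rightarrow> nat \<Rightarrow> nat \<Rightarrow> real \<Rightarrow> real" where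
  "u_left M Y a b x z = (LINT \<omega>|given_start M Y x.
      z ^ the_enat (hit_time {a} (\<lambda>n. Y n \<omega>)) *
      of_bool (hit_time {a} (\<lambda>n. Y n \<omega>) < hit_time {b..} (\<lambda>n. Y n \<omega>)))"

definition u_left_infinity_fps ::
    "'a measure \<Rightarrow> (nat \<Rightarrow> 'a \<Rightarrow> nat) \<Rightarrow> nat \<Rightarrow> real fps" where
  "u_left_infinity_fps M Y x = fps_expectation (given_start M Y x)
     (\<lambda>\<omega>. fps_X ^ the_enat (hit_time {0} (\<lambda>n. Y n \<omega>)) *
           of_bool (hit_time {0} (\<lambda>n. Y n \<omega>) < \<infinity>))"

definition u_left_infinity ::
    "'a measure \<Rightarrow> (nat \<Rightarrow> 'a \<Rightarrow> nat) \<Rightarrow> nat \<Rightarrow> real \<Rightarrow> real" where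
  "u_left_infinity M Y x z = (LINT \<omega>|given_start M Y x.
      z ^ the_enat (hit_time {0} (\<lambda>n. Y n \<omega>)) *
      of_bool (hit_time {0} (\<lambda>n. Y n \<omega>) < \<infinity>))"

definition hit_zero_gf_fps ::
    "'a measure \<Rightarrow> (nat \<Rightarrow> 'a \<Rightarrow> nat) \<Rightarrow> nat \<Rightarrow> real fps" where
  "hit_zero_gf_fps M Y x = fps_expectation (given_start M Y x)
     (\<lambda>\<omega>. fps_X ^ the_enat (hit_time {0} (\<lambda>n. Y n \<omega>)))"

definition hit_zero_gf ::
    "'a measure \<Rightarrow> (nat \<Rightarrow> 'a \<Rightarrow> nat) \<Rightarrow> nat \<Rightarrow> real \<Rightarrow> real" where
  "hit_zero_gf M Y x z = (LINT \<omega>|given_start M Y x.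
      z ^ the_enat (hit_time {0} (\<lambda>n. Y n \<omega>)))"

text \<open>
  The block of \<open>U\<close> with rows and columns indexed by the integers from \<open>a\<close> to \<open>b\<close>; it is the \<open>0 \<times> 0\<close>
  matrix (of determinant \<open>1\<close>) if \<open>a = b + 1\<close>.
\<close>

definition index_block :: "(nat \<Rightarrow> nat \<Rightarrow> real) \<Rightarrow> nat \<Rightarrow> nat \<Rightarrow> real mat" where
  "index_block U a b = Matrix.mat (Suc b - a) (Suc b - a) (\<lambda>(i, j). U (a + i) (a + j))"

definition char_det_fps :: "(nat \<Rightarrow> nat \<Rightarrow> real) \<Rightarrow> nat \<Rightarrow> nat \<Rightarrow> real fps" where
  "char_det_fps U a b = Determinant.det
     (1\<^sub>m (Suc b - a) - fps_X \<cdot>\<^sub>m map_mat fps_const (index_block U a b))"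

definition char_det :: "(nat \<Rightarrow> nat \<Rightarrow> real) \<Rightarrow> nat \<Rightarrow> nat \<Rightarrow> real \<Rightarrow> real" where
  "char_det U a b z = Determinant.det (1\<^sub>m (Suc b - a) - z \<cdot>\<^sub>m index_block U a b)"

end

theory Submission
  imports Defs
begin

text \<open>
  The idea is a boundary value problem. Write \<open>v\<^sub>x\<close> for the generating function of the first hitting
  time of \<open>a\<close>, killed on reaching \<open>[b, \<infinity>)\<close>, and put \<open>v\<^sub>a = 1\<close>. Conditioning on the first step
  gives \<open>v\<^sub>x = z \<Sum>\<^bsub>y<b\<^esub> U\<^bsub>x,y\<^esub> v\<^sub>y\<close> for \<open>a < x < b\<close>. From \<open>x > a\<close> the chain
  cannot pass below \<open>a\<close> without visiting it, so the equations involve the sites \<open>a, ..., b - 1\<close> only,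
  and \<open>v\<^sub>a\<close> enters the single equation for \<open>x = a + 1\<close>. Cramer's rule for this first unknown is
  immediate: replacing the first column of \<open>Id - zU\<^bsub>[a+1,b-1]\<^esub>\<close> leaves
  \<open>zU\<^bsub>a+1,a\<^esub> det (Id - zU\<^bsub>[a+2,b-1]\<^esub>)\<close>. The other unknowns need no further
  determinants, since the same \<open>v\<close> solves the problem with boundary point \<open>a + 1\<close>; iterating, the
  determinants telescope (\<open>hessenberg_exit_formula\<close>). The argument works in any integral domain, so it
  applies both to power series and to real \<open>z\<close> with \<open>\<bar>z\<bar> < 1\<close>, once the determinants are known
  not to vanish: over power series the constant term is \<open>1\<close>, over the reals \<open>zU\<close>
  is a contraction for the supremum norm, so \<open>Id - zU\<close> is injective on every block.

  The link to the chain is \<open>prob_cylinder_first_passage\<close>: after any fixed past, the distribution of the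
  first passage time depends on the present state only and is given by the recursion \<open>first_passage\<close>.

  For \<open>b \<rightarrow> \<infinity>\<close>, a path that hits \<open>0\<close> at a finite time is bounded up to that time, so the
  probability of hitting \<open>0\<close>, but not before \<open>[b, \<infinity>)\<close>, tends to \<open>0\<close>. This probability bounds
  the error of every expectation of a function of the hitting time \<open>\<tau>\<close> of \<open>0\<close> with values in \<open>[-1, 1]\<close>
  (\<open>weighted_hit_before_le\<close>): the indicator of \<open>\<tau> = k\<close> gives the coefficients, and \<open>z\<^sup>\<tau>\<close> gives
  uniform convergence.

  If \<open>U\<close> is recurrent, it remains to see that \<open>\<tau>\<close> is almost surely finite from every \<open>x\<close>.
  Recurrence at \<open>0\<close> is a statement about a chain started at \<open>0\<close>. Such a chain is found inside the given one:
  by irreducibility some path from \<open>x\<close> to \<open>0\<close> has positive probability, and the future after this path,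
  conditioned on it, is a chain from \<open>0\<close> (\<open>markov_chain_future_law\<close>). So the return probability from
  \<open>0\<close> is \<open>1\<close>. A state from which \<open>0\<close> is hit almost surely passes this property on to its successors
  (\<open>return_from_successor\<close>), and every state is reachable from \<open>0\<close>.
\<close>

section \<open>The boundary value problem for a Hessenberg matrix\<close>

text \<open>
  The matrix \<open>Id - W\<^bsub>[m,b-1]\<^esub>\<close>. Indexing by the excluded upper end \<open>b\<close> makes it the empty matrix for
  \<open>m = b\<close>, where an inclusive upper end \<open>b - 1\<close> would need care with subtraction.
\<close>

definition id_minus_block :: "(nat \<Rightarrow> nat \<Rightarrow> 'a::comm_ring_1) \<Rightarrow> nat \<Rightarrow> nat \<Rightarrow> 'a mat" where
  "id_minus_block W b m = Matrix.mat (b - m) (b - m) (\<lambda>(i, j). of_bool (i = j) - W (m + i) (m + j))"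

lemma id_minus_block_carrier [simp]: "id_minus_block W b m \<in> carrier_mat (b - m) (b - m)"
  by (simp add: id_minus_block_def)

lemma sum_id_minus_mult:
  fixes c u :: "nat \<Rightarrow> 'a::comm_ring_1"
  assumes "i < n"
  shows "(\<Sum>j<n. (of_bool (i = j) - c j) * u j) = u i - (\<Sum>j<n. c j * u j)"
proof -
  have "(\<Sum>j<n. of_bool (i = j) * u j) = (\<Sum>j<n. if i = j then u j else 0)"
    by (intro sum.cong) auto
  with assms show ?thesis
    by (simp add: left_diff_distrib sum_subtractf)
qed

text \<open>
  The vector \<open>(v\<^bsub>a+1\<^esub>, ..., v\<^bsub>b-1\<^esub>)\<close> solves a linear system whose right-hand side is
  supported on the first row, because only row \<open>a + 1\<close> of a Hessenberg matrix reaches down to \<open>a\<close>.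
  In Cramer's rule for the first unknown that right-hand side replaces the first column, and
  Laplace expansion along it has one term.
\<close>

lemma cramer_first_unknown:
  fixes W :: "nat \<Rightarrow> nat \<Rightarrow> 'a::comm_ring_1"
  assumes hess: "\<And>i j. j + 1 < i \<Longrightarrow> W i j = 0"
    and harmonic: "\<And>x. a < x \<Longrightarrow> x < b \<Longrightarrow> v x = (\<Sum>y<b. W x y * v y)"
    and ab: "a + 1 < b"
  shows "det (id_minus_block W b (a + 1)) * v (a + 1) =
         W (a + 1) a * det (id_minus_block W b (a + 2)) * v a"
proof -
  define n where "n = b - (a + 1)"
  define D where "D = id_minus_block W b (a + 1)"
  define w where "w = Matrix.vec n (\<lambda>i. v (a + 1 + i))"
  have n: "0 < n" using ab by (simp add: n_def)
  have D: "D \<in> carrier_mat n n" by (simp add: D_def n_def)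
  have w: "w \<in> carrier_vec n" by (simp add: w_def)
  have Dw: "vec_index (D *\<^sub>v w) i = (if i = 0 then W (a + 1) a * v a else 0)" if i: "i < n" for i
  proof -
    have "vec_index (D *\<^sub>v w) i =
        (\<Sum>j<n. (of_bool (i = j) - W (a + 1 + i) (a + 1 + j)) * v (a + 1 + j))"
      using i by (simp add: D_def id_minus_block_def w_def n_def scalar_prod_def lessThan_atLeast0
          mult_mat_vec_def)
    also have "\<dots> = v (a + 1 + i) - (\<Sum>j<n. W (a + 1 + i) (a + 1 + j) * v (a + 1 + j))"
      using i by (rule sum_id_minus_mult)
    also have "(\<Sum>j<n. W (a + 1 + i) (a + 1 + j) * v (a + 1 + j)) =
        (\<Sum>y\<in>{a + 1..<b}. W (a + 1 + i) y * v y)"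
      by (rule sum.reindex_bij_witness[of _ "\<lambda>y. y - (a + 1)" "\<lambda>j. a + 1 + j"])
        (auto simp: n_def)
    also have "v (a + 1 + i) = (\<Sum>y<b. W (a + 1 + i) y * v y)"
      using i by (intro harmonic) (auto simp: n_def)
    also have "(\<Sum>y<b. W (a + 1 + i) y * v y) =
        (\<Sum>y<a+1. W (a + 1 + i) y * v y) + (\<Sum>y\<in>{a + 1..<b}. W (a + 1 + i) y * v y)"
      unfolding lessThan_atLeast0 using ab by (intro sum.atLeastLessThan_concat[symmetric]) auto
    also have "(\<Sum>y<a+1. W (a + 1 + i) y * v y) = W (a + 1 + i) a * v a"
      by (simp add: hess)
    finally show ?thesis by (auto simp: hess)
  qed
  define C where "C = replace_col D (D *\<^sub>v w) 0"
  have C: "C \<in> carrier_mat n n" using D by (simp add: C_def replace_col_def)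
  have "vec_index w 0 * det D = det C"
    unfolding C_def using cramer_lemma_mat[OF D w n] by simp
  also have "\<dots> = (\<Sum>i<n. C $$ (i, 0) * cofactor C i 0)"
    by (rule laplace_expansion_column[OF C n])
  also have "\<dots> = (\<Sum>i<n. if i = 0 then W (a + 1) a * v a * cofactor C 0 0 else 0)"
    using D by (intro sum.cong) (auto simp: C_def replace_col_def Dw simp del: index_mult_mat_vec)
  also have "\<dots> = W (a + 1) a * v a * cofactor C 0 0"
    using n by simp
  also have "mat_delete C 0 0 = id_minus_block W b (a + 2)"
    using D n by (intro eq_matI)
      (auto simp: C_def mat_delete_def replace_col_def D_def id_minus_block_def n_def)
  then have "cofactor C 0 0 = det (id_minus_block W b (a + 2))"
    by (simp add: cofactor_def)
  finally show ?thesis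
    using n by (simp add: D_def w_def algebra_simps)
qed

text \<open>
  Induction moving the boundary point \<open>a\<close> up to \<open>x\<close>: a solution for \<open>a\<close> is a solution for
  \<open>a + 1\<close>, so Cramer's rule for the first unknown suffices at every step, and the intermediate
  determinant cancels.
\<close>

lemma hessenberg_exit_formula:
  fixes W :: "nat \<Rightarrow> nat \<Rightarrow> 'a::idom"
  assumes hess: "\<And>i j. j + 1 < i \<Longrightarrow> W i j = 0"
    and regular: "\<And>m. det (id_minus_block W b m) \<noteq> 0"
    and "a < x" "x < b"
    and "\<And>y. a < y \<Longrightarrow> y < b \<Longrightarrow> v y = (\<Sum>k<b. W y k * v k)"
  shows "det (id_minus_block W b (a + 1)) * v x =
         det (id_minus_block W b (x + 1)) * (\<Prod>j=a+1..x. W j (j - 1)) * v a"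
  using assms(3-)
proof (induction "x - a" arbitrary: a)
  case 0
  then show ?case by simp
next
  case (Suc d)
  have cramer: "det (id_minus_block W b (a + 1)) * v (a + 1) =
         W (a + 1) a * det (id_minus_block W b (a + 2)) * v a"
    using Suc.prems by (intro cramer_first_unknown hess) auto
  show ?case
  proof (cases "x = a + 1")
    case True
    then show ?thesis using cramer by (simp add: mult_ac)
  next
    case False
    have IH: "det (id_minus_block W b (a + 2)) * v x =
         det (id_minus_block W b (x + 1)) * (\<Prod>j=a+2..x. W j (j - 1)) * v (a + 1)"
      using Suc.hyps(1)[of "a + 1"] Suc.hyps(2) Suc.prems False by simp
    have prod: "(\<Prod>j=a+1..x. W j (j - 1)) = W (a + 1) a * (\<Prod>j=a+2..x. W j (j - 1))"
      using Suc.prems by (simp add: prod.atLeast_Suc_atMost)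
    let ?p = "\<Prod>j=a+2..x. W j (j - 1)"
    have "det (id_minus_block W b (a + 2)) * (det (id_minus_block W b (a + 1)) * v x) =
        det (id_minus_block W b (a + 1)) * (det (id_minus_block W b (x + 1)) * ?p * v (a + 1))"
      using IH by (simp add: mult_ac)
    also have "\<dots> = det (id_minus_block W b (x + 1)) * ?p *
        (det (id_minus_block W b (a + 1)) * v (a + 1))"
      by (simp add: mult_ac)
    also have "\<dots> = det (id_minus_block W b (a + 2)) *
        (det (id_minus_block W b (x + 1)) * (\<Prod>j=a+1..x. W j (j - 1)) * v a)"
      by (simp only: cramer prod) (simp add: mult_ac)
    finally show ?thesis
      using regular[of "a + 2"] by simp
  qed
qed

text \<open>
  If \<open>v = z U v\<close> on a finite block, evaluate at the entry of \<open>v\<close> of largest absolute value \<open>c\<close>: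
  the rows of \<open>U\<close> have sum at most \<open>1\<close> on the block, so \<open>c \<le> \<bar>z\<bar> c\<close>, and hence \<open>c = 0\<close>.
\<close>

lemma det_id_minus_block_real_nonzero:
  assumes U: "transition_matrix U" and z: "\<bar>z\<bar> < 1"
  shows "det (id_minus_block (\<lambda>i j. z * U i j) b m) \<noteq> 0"
proof
  define n where "n = b - m"
  let ?D = "id_minus_block (\<lambda>i j. z * U i j) b m"
  have D: "?D \<in> carrier_mat n n" by (simp add: n_def)
  assume "det ?D = 0"
  then obtain v where v: "v \<in> carrier_vec n" "v \<noteq> 0\<^sub>v n" "?D *\<^sub>v v = 0\<^sub>v n"
    using det_0_iff_vec_prod_zero_field[OF D] by blast
  have n: "n > 0" using v by (intro gr0I) auto
  define c where "c = Max ((\<lambda>i. \<bar>vec_index v i\<bar>) ` {..<n})"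
  have c: "\<bar>vec_index v i\<bar> \<le> c" if "i < n" for i
    using that by (auto simp: c_def)
  have "c \<in> (\<lambda>i. \<bar>vec_index v i\<bar>) ` {..<n}"
    unfolding c_def using n by (intro Max_in) auto
  then obtain k where k: "k < n" "\<bar>vec_index v k\<bar> = c" by auto
  have "c > 0"
  proof (rule ccontr)
    assume "\<not> c > 0"
    then have "vec_index v i = 0" if "i < n" for i
      using c[OF that] by simp
    then have "v = 0\<^sub>v n" using v(1) by (intro eq_vecI) auto
    with v(2) show False by simp
  qed
  have "0 = vec_index (?D *\<^sub>v v) k" using k v by simp
  also have "\<dots> = (\<Sum>j<n. (of_bool (k = j) - z * U (m + k) (m + j)) * vec_index v j)"
    using k v(1) by (simp add: id_minus_block_def n_def scalar_prod_def lessThan_atLeast0)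
  also have "\<dots> = vec_index v k - z * (\<Sum>j<n. U (m + k) (m + j) * vec_index v j)"
    using k by (simp add: sum_id_minus_mult sum_distrib_left mult.assoc)
  finally have "c = \<bar>z\<bar> * \<bar>\<Sum>j<n. U (m + k) (m + j) * vec_index v j\<bar>"
    using k by (simp add: abs_mult)
  also have "\<dots> \<le> \<bar>z\<bar> * (\<Sum>j<n. U (m + k) (m + j) * c)"
    using U c by (intro mult_left_mono order.trans[OF sum_abs] sum_mono)
      (auto simp: abs_mult transition_matrix_def intro!: mult_mono)
  also have "(\<Sum>j<n. U (m + k) (m + j) * c) = (\<Sum>j\<in>{m..<m+n}. U (m + k) j) * c"
    unfolding sum_distrib_right
    by (rule sum.reindex_bij_witness[of _ "\<lambda>y. y - m" "\<lambda>j. m + j"]) auto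
  also have "(\<Sum>j\<in>{m..<m+n}. U (m + k) j) \<le> (\<Sum>j. U (m + k) j)"
    using U by (intro sum_le_suminf) (auto simp: transition_matrix_def sums_iff)
  also have "\<dots> = 1" using U by (simp add: transition_matrix_def sums_iff)
  finally have "c \<le> \<bar>z\<bar> * c"
    using \<open>c > 0\<close> by (simp add: mult_left_mono mult_right_mono)
  then show False using z \<open>c > 0\<close> by simp
qed

lemma det_id_minus_block_fps_nth_0:
  fixes U :: "nat \<Rightarrow> nat \<Rightarrow> real"
  shows "fps_nth (det (id_minus_block (\<lambda>i j. fps_X * fps_const (U i j)) b m)) 0 = 1"
proof -
  let ?D = "id_minus_block (\<lambda>i j. fps_X * fps_const (U i j)) b m"
  interpret const_term: comm_ring_hom "\<lambda>f::real fps. fps_nth f 0"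
    by unfold_locales auto
  have "map_mat (\<lambda>f. fps_nth f 0) ?D = 1\<^sub>m (b - m)"
    by (intro eq_matI) (auto simp: id_minus_block_def)
  then show ?thesis
    using const_term.hom_det[of ?D] by simp
qed

lemma char_det_eq:
  assumes "b > 0"
  shows "char_det_fps U m (b - 1) = det (id_minus_block (\<lambda>i j. fps_X * fps_const (U i j)) b m)"
    and "char_det U m (b - 1) z = det (id_minus_block (\<lambda>i j. z * U i j) b m)"
proof -
  have b: "Suc (b - 1) = b" using assms by simp
  show "char_det_fps U m (b - 1) = det (id_minus_block (\<lambda>i j. fps_X * fps_const (U i j)) b m)"
    unfolding char_det_fps_def index_block_def id_minus_block_def b
    by (intro arg_cong[where f = det] eq_matI) auto
  show "char_det U m (b - 1) z = det (id_minus_block (\<lambda>i j. z * U i j) b m)"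
    unfolding char_det_def index_block_def id_minus_block_def b
    by (intro arg_cong[where f = det] eq_matI) auto
qed

section \<open>First passage probabilities\<close>

text \<open>
  Started at \<open>x\<close>, the probability of being at \<open>a\<close> at time \<open>k + 1\<close> with all states at the times
  \<open>1, ..., k\<close> in \<open>S\<close>. The shift by one avoids a case distinction: first passage takes at least one step.
\<close>

primrec first_passage :: "(nat \<Rightarrow> nat \<Rightarrow> real) \<Rightarrow> nat set \<Rightarrow> nat \<Rightarrow> nat \<Rightarrow> nat \<Rightarrow> real" where
  "first_passage U S a 0 = (\<lambda>x. U x a)"
| "first_passage U S a (Suc k) = (\<lambda>x. \<Sum>y. U x y * (of_bool (y \<in> S) * first_passage U S a k y))"

lemma transition_matrix_simps:
  assumes "transition_matrix U"
  shows "0 \<le> U i j" "summable (U i)" "suminf (U i) = 1"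
  using assms by (auto simp: transition_matrix_def sums_iff)

lemma summable_row_mult:
  assumes U: "transition_matrix U" and f: "\<And>y. \<bar>f y\<bar> \<le> (1::real)"
  shows "summable (\<lambda>y. U x y * f y)"
proof (rule summable_comparison_test'[where N = 0])
  show "summable (U x)" using U by (rule transition_matrix_simps)
  show "norm (U x y * f y) \<le> U x y" for y
    using transition_matrix_simps(1)[OF U] f[of y] mult_left_mono[OF f[of y], of "U x y"]
    by (simp add: abs_mult)
qed

lemma row_mean_le_1:
  assumes U: "transition_matrix U" and f: "\<And>y. 0 \<le> f y" "\<And>y. f y \<le> (1::real)"
  shows "0 \<le> (\<Sum>y. U x y * f y)" "(\<Sum>y. U x y * f y) \<le> 1"
proof -
  have s: "summable (\<lambda>y. U x y * f y)"
    using f by (intro summable_row_mult U) (simp add: abs_le_iff order.trans[of _ 0])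
  show "0 \<le> (\<Sum>y. U x y * f y)"
    using f transition_matrix_simps[OF U] by (intro suminf_nonneg s) auto
  have "(\<Sum>y. U x y * f y) \<le> (\<Sum>y. U x y)"
    using f transition_matrix_simps[OF U] by (intro suminf_le s) (auto intro: mult_left_le)
  then show "(\<Sum>y. U x y * f y) \<le> 1"
    using transition_matrix_simps[OF U] by simp
qed

lemma first_passage_bounds:
  assumes U: "transition_matrix U"
  shows "0 \<le> first_passage U S a k x" "first_passage U S a k x \<le> 1"
proof -
  have "0 \<le> first_passage U S a k x \<and> first_passage U S a k x \<le> 1"
  proof (induction k arbitrary: x)
    case 0
    have "U x a = sum (U x) {a}" by simp
    also have "\<dots> \<le> suminf (U x)"
      using transition_matrix_simps[OF U] by (intro sum_le_suminf) auto
    finally show ?case using transition_matrix_simps[OF U] by simp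
  next
    case (Suc k)
    show ?case
      unfolding first_passage.simps
      using Suc by (intro conjI row_mean_le_1 U) (auto simp: of_bool_def)
  qed
  then show "0 \<le> first_passage U S a k x" "first_passage U S a k x \<le> 1" by auto
qed

text \<open>
  The assumption on \<open>U\<close> is separate, because the Markov property constrains only the rows of \<open>U\<close>
  that belong to states visited with positive probability.
\<close>

locale homogeneous_chain = prob_space M for M :: "'a measure" +
  fixes Y :: "nat \<Rightarrow> 'a \<Rightarrow> nat" and U :: "nat \<Rightarrow> nat \<Rightarrow> real"
  assumes chain: "markov_chain M Y U" and U: "transition_matrix U"
begin

lemma measurable_Y [measurable]: "Y n \<in> measurable M (count_space UNIV)"
  using chain by (simp add: markov_chain_def)

lemma prob_cylinder_Suc:
  "\<P>(\<omega> in M. (\<forall>k\<le>n. Y k \<omega> = p k) \<and> Y (Suc n) \<omega> = j) =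
   \<P>(\<omega> in M. \<forall>k\<le>n. Y k \<omega> = p k) * U (p n) j"
proof (cases "\<P>(\<omega> in M. \<forall>k\<le>n. Y k \<omega> = p k) = 0")
  case True
  have "\<P>(\<omega> in M. (\<forall>k\<le>n. Y k \<omega> = p k) \<and> Y (Suc n) \<omega> = j) \<le>
        \<P>(\<omega> in M. \<forall>k\<le>n. Y k \<omega> = p k)"
    by (intro finite_measure_mono) auto
  then show ?thesis using True by (simp add: measure_le_0_iff)
next
  case False
  then have "\<P>(\<omega> in M. \<forall>k\<le>n. Y k \<omega> = p k) > 0"
    by (simp add: zero_less_measure_iff)
  moreover from this have "\<P>(\<omega> in M. Y (Suc n) \<omega> = j \<bar> \<forall>k\<le>n. Y k \<omega> = p k) = U (p n) j"
    using chain by (simp add: markov_chain_def)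
  ultimately show ?thesis
    by (simp add: cond_prob_def field_simps conj_commute)
qed

text \<open>
  The Markov property for a fixed past, extended from one step to the whole first passage:
  disjoint decomposition according to the state \<open>y\<close> at time \<open>n + 1\<close>, which then becomes part of the past.
\<close>

lemma prob_cylinder_first_passage:
  "\<P>(\<omega> in M. (\<forall>j\<le>n. Y j \<omega> = p j) \<and> (\<forall>j. n < j \<and> j \<le> n + k \<longrightarrow> Y j \<omega> \<in> S) \<and>
       Y (Suc (n + k)) \<omega> = a) =
   \<P>(\<omega> in M. \<forall>j\<le>n. Y j \<omega> = p j) * first_passage U S a k (p n)"
proof (induction k arbitrary: n p)
  case 0
  have "{\<omega> \<in> space M. (\<forall>j\<le>n. Y j \<omega> = p j) \<and> (\<forall>j. n < j \<and> j \<le> n + 0 \<longrightarrow> Y j \<omega> \<in> S) \<and>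
      Y (Suc (n + 0)) \<omega> = a} = {\<omega> \<in> space M. (\<forall>j\<le>n. Y j \<omega> = p j) \<and> Y (Suc n) \<omega> = a}"
    by auto
  then show ?case by (simp add: prob_cylinder_Suc)
next
  case (Suc k)
  let ?E = "\<lambda>n p k. {\<omega> \<in> space M. (\<forall>j\<le>n. Y j \<omega> = p j) \<and>
    (\<forall>j. n < j \<and> j \<le> n + k \<longrightarrow> Y j \<omega> \<in> S) \<and> Y (Suc (n + k)) \<omega> = a}"
  let ?A = "\<lambda>y. if y \<in> S then ?E (Suc n) (p(Suc n := y)) k else {}"
  let ?P = "\<P>(\<omega> in M. \<forall>j\<le>n. Y j \<omega> = p j)"
  have pA: "prob (?A y) = ?P * (U (p n) y * (of_bool (y \<in> S) * first_passage U S a k y))" for y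
  proof (cases "y \<in> S")
    case True
    have eq: "(\<forall>j\<le>Suc n. Y j \<omega> = (p(Suc n := y)) j) \<longleftrightarrow> (\<forall>j\<le>n. Y j \<omega> = p j) \<and> Y (Suc n) \<omega> = y" for \<omega>
      by (auto simp: le_Suc_eq)
    show ?thesis
      using True Suc.IH[of "Suc n" "p(Suc n := y)"]
      by (simp add: eq prob_cylinder_Suc mult.assoc del: fun_upd_apply)
         (simp add: eq mult.assoc)
  qed simp
  have union: "?E n p (Suc k) = (\<Union>y. ?A y)"
  proof (intro equalityI subsetI)
    fix \<omega> assume "\<omega> \<in> ?E n p (Suc k)"
    then have "\<omega> \<in> ?A (Y (Suc n) \<omega>)"
      by (auto simp: le_Suc_eq)
    then show "\<omega> \<in> (\<Union>y. ?A y)" by blast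
  next
    fix \<omega> assume "\<omega> \<in> (\<Union>y. ?A y)"
    then obtain y where "\<omega> \<in> ?A y"
      by blast
    then have y: "y \<in> S" "\<omega> \<in> ?E (Suc n) (p(Suc n := y)) k"
      by (simp_all split: if_splits del: fun_upd_apply)
    then have "Y j \<omega> \<in> S" if "n < j" "j \<le> n + Suc k" for j
      using that by (cases "j = Suc n") auto
    with y show "\<omega> \<in> ?E n p (Suc k)" 
      by (auto simp: le_Suc_eq)
  qed
  have "(\<lambda>y. prob (?A y)) sums prob (\<Union>y. ?A y)"
  proof (rule finite_measure_UNION)
    show "range ?A \<subseteq> events" by auto
    show "disjoint_family ?A"
      by (auto simp: disjoint_family_on_def split: if_splits)
  qed
  then have "(\<lambda>y. ?P * (U (p n) y * (of_bool (y \<in> S) * first_passage U S a k y))) sums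
      prob (?E n p (Suc k))"
    unfolding pA union .
  moreover have "summable (\<lambda>y. U (p n) y * (of_bool (y \<in> S) * first_passage U S a k y))"
    by (intro summable_row_mult U) (use first_passage_bounds[OF U] in \<open>auto simp: of_bool_def\<close>)
  then have "(\<lambda>y. ?P * (U (p n) y * (of_bool (y \<in> S) * first_passage U S a k y))) sums
      (?P * first_passage U S a (Suc k) (p n))"
    by (auto simp: intro!: sums_mult summable_sums)
  ultimately show ?case
    using sums_unique2 by blast
qed

end

section \<open>Hitting times\<close>

lemma less_hit_time_iff: "enat k < hit_time S y \<longleftrightarrow> (\<forall>j. 0 < j \<and> j \<le> k \<longrightarrow> y j \<notin> S)"
proof -
  let ?J = "{j. j > 0 \<and> y j \<in> S}"
  show ?thesis
  proof (cases "?J = {}")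
    case True
    then have "hit_time S y = \<infinity>"
      unfolding hit_time_def by (simp only: image_empty Inf_enat_def simp_thms if_True)
    with True show ?thesis by (simp, blast)
  next
    case False
    then obtain i where i: "i \<in> ?J" by auto
    have "hit_time S y \<in> enat ` ?J"
      unfolding hit_time_def by (rule wellorder_InfI, rule imageI, rule i)
    then obtain m where m: "m \<in> ?J" "hit_time S y = enat m" by auto
    have least: "m \<le> j" if "j \<in> ?J" for j
    proof -
      have "hit_time S y \<le> enat j"
        unfolding hit_time_def using that by (intro Inf_lower imageI)
      with m show ?thesis by simp
    qed
    show ?thesis
    proof
      assume "enat k < hit_time S y"
      with m(2) have "k < m" by simp
      then show "\<forall>j. 0 < j \<and> j \<le> k \<longrightarrow> y j \<notin> S" using least by force
    next
      assume "\<forall>j. 0 < j \<and> j \<le> k \<longrightarrow> y j \<notin> S"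
      then have "\<not> m \<le> k" using m(1) by blast
      with m(2) show "enat k < hit_time S y" by simp
    qed
  qed
qed

lemma hit_time_eq_enat_iff:
  "hit_time S y = enat k \<longleftrightarrow> 0 < k \<and> y k \<in> S \<and> (\<forall>j. 0 < j \<and> j < k \<longrightarrow> y j \<notin> S)"
proof (cases k)
  case 0
  then show ?thesis using less_hit_time_iff[of 0 S y] by auto
next
  case (Suc i)
  have "hit_time S y = enat k \<longleftrightarrow> \<not> enat k < hit_time S y \<and> enat i < hit_time S y"
    using Suc by (cases "hit_time S y") auto
  then show ?thesis
    unfolding less_hit_time_iff Suc by (auto simp: le_Suc_eq less_Suc_eq_le)
qed

text \<open>
  Hitting \<open>a\<close> before \<open>[b, \<infinity>)\<close> is a first passage to \<open>a\<close> with a constraint on the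
  intermediate states. The condition \<open>a < b\<close> ensures that the two targets are disjoint.
\<close>

lemma hit_time_before_iff:
  assumes "a < b"
  shows "hit_time {a} y = enat (Suc k) \<and> hit_time {a} y < hit_time {b..} y \<longleftrightarrow>
     (\<forall>j. 0 < j \<and> j \<le> k \<longrightarrow> y j \<in> {..<b} - {a}) \<and> y (Suc k) = a"
proof -
  have "hit_time {a} y = enat (Suc k) \<and> hit_time {a} y < hit_time {b..} y \<longleftrightarrow>
     hit_time {a} y = enat (Suc k) \<and> enat (Suc k) < hit_time {b..} y" by auto
  moreover have "(\<forall>j. 0 < j \<and> j \<le> Suc k \<longrightarrow> y j \<notin> {b..}) \<longleftrightarrow>
      y (Suc k) < b \<and> (\<forall>j. 0 < j \<and> j \<le> k \<longrightarrow> y j < b)"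
    by (simp add: le_Suc_eq not_le) blast
  ultimately show ?thesis
    unfolding hit_time_eq_enat_iff less_hit_time_iff less_Suc_eq_le using assms by auto
qed

lemma hit_time_singleton_iff:
  "hit_time {a} y = enat (Suc k) \<longleftrightarrow> (\<forall>j. 0 < j \<and> j \<le> k \<longrightarrow> y j \<in> - {a}) \<and> y (Suc k) = a"
  unfolding hit_time_eq_enat_iff by (auto simp: less_Suc_eq_le)

lemma hit_time_neq_0: "hit_time S y \<noteq> 0"
  unfolding zero_enat_def hit_time_eq_enat_iff by simp

lemma hit_time_atLeast_mono: "b \<le> c \<Longrightarrow> hit_time {b..} y \<le> hit_time {c..} y"
  unfolding hit_time_def by (intro Inf_superset_mono) auto

lemma hit_time_less_finite: "hit_time S y < t \<Longrightarrow> hit_time S y < \<infinity>"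
  by (cases "hit_time S y") auto

lemma ex_hit_before:
  assumes "hit_time {a} y < \<infinity>"
  shows "\<exists>b. hit_time {a} y < hit_time {b..} y"
proof -
  obtain k where k: "hit_time {a} y = enat k" using assms by auto
  have "y j < Suc (Max (y ` {..k}))" if "j \<le> k" for j
    using that by (auto simp: less_Suc_eq_le)
  then have "enat k < hit_time {Suc (Max (y ` {..k}))..} y"
    unfolding less_hit_time_iff by (auto simp: not_le)
  with k show ?thesis by auto
qed

context homogeneous_chain
begin

lemma measurable_hit_time [measurable]:
  "(\<lambda>\<omega>. hit_time S (\<lambda>n. Y n \<omega>)) \<in> measurable M (count_space UNIV)"
proof -
  have fin: "(\<lambda>\<omega>. hit_time S (\<lambda>n. Y n \<omega>)) -` {enat k} \<inter> space M \<in> sets M" for k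
  proof -
    have "(\<lambda>\<omega>. hit_time S (\<lambda>n. Y n \<omega>)) -` {enat k} \<inter> space M =
        {\<omega> \<in> space M. 0 < k \<and> Y k \<omega> \<in> S \<and> (\<forall>j. 0 < j \<and> j < k \<longrightarrow> Y j \<omega> \<notin> S)}"
      by (auto simp: hit_time_eq_enat_iff)
    also have "\<dots> \<in> sets M" by measurable
    finally show ?thesis .
  qed
  have inf: "(\<lambda>\<omega>. hit_time S (\<lambda>n. Y n \<omega>)) -` {\<infinity>} \<inter> space M \<in> sets M"
  proof -
    have "(\<lambda>\<omega>. hit_time S (\<lambda>n. Y n \<omega>)) -` {\<infinity>} \<inter> space M =
        space M - (\<Union>k. (\<lambda>\<omega>. hit_time S (\<lambda>n. Y n \<omega>)) -` {enat k} \<inter> space M)"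
      by (auto simp: not_infinity_eq)
    also have "\<dots> \<in> sets M"
      using fin by (intro sets.Diff sets.top sets.countable_UN) auto
    finally show ?thesis .
  qed
  show ?thesis
    unfolding measurable_count_space_eq_countable[OF countableI_type]
  proof (intro conjI ballI)
    fix t :: enat
    show "(\<lambda>\<omega>. hit_time S (\<lambda>n. Y n \<omega>)) -` {t} \<inter> space M \<in> sets M"
      using fin inf by (cases t) auto
  qed auto
qed

lemma pred_hit_time_less [measurable]:
  "Measurable.pred M (\<lambda>\<omega>. hit_time S (\<lambda>n. Y n \<omega>) < hit_time T (\<lambda>n. Y n \<omega>))"
  by (rule measurable_compose_countable[OF _ measurable_hit_time,
        of "\<lambda>t \<omega>. hit_time S (\<lambda>n. Y n \<omega>) < t"])
    (rule measurable_compose[OF measurable_hit_time measurable_count_space])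

lemma pred_hit_time_finite [measurable]:
  "Measurable.pred M (\<lambda>\<omega>. hit_time S (\<lambda>n. Y n \<omega>) < \<infinity>)"
  by (rule measurable_compose[OF measurable_hit_time measurable_count_space])

end

locale chain_started_at = homogeneous_chain +
  fixes x :: nat
  assumes start: "\<P>(\<omega> in M. Y 0 \<omega> = x) > 0"
begin

abbreviation "N \<equiv> given_start M Y x"
abbreviation "\<tau> a \<omega> \<equiv> hit_time {a} (\<lambda>n. Y n \<omega>)"
abbreviation "\<sigma> b \<omega> \<equiv> hit_time {b..} (\<lambda>n. Y n \<omega>)"

lemma emeasure_start: "emeasure M {\<omega> \<in> space M. Y 0 \<omega> = x} \<noteq> 0"
    "emeasure M {\<omega> \<in> space M. Y 0 \<omega> = x} \<noteq> \<infinity>"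
  using start by (auto simp: emeasure_eq_measure)

lemma space_N [simp]: "space N = space M" and sets_N [simp, measurable_cong]: "sets N = sets M"
  by (auto simp: given_start_def)

sublocale N: prob_space N
  unfolding given_start_def by (intro prob_space_uniform_measure emeasure_start)

text \<open>
  The case of a past that consists of the initial state only.
\<close>

lemma N_first_passage:
  "measure N {\<omega> \<in> space M. (\<forall>j. 0 < j \<and> j \<le> k \<longrightarrow> Y j \<omega> \<in> S) \<and> Y (Suc k) \<omega> = a} =
   first_passage U S a k x"
proof -
  let ?B = "{\<omega> \<in> space M. (\<forall>j. 0 < j \<and> j \<le> k \<longrightarrow> Y j \<omega> \<in> S) \<and> Y (Suc k) \<omega> = a}"
  let ?A = "{\<omega> \<in> space M. Y 0 \<omega> = x}"
  have "measure N ?B = prob (?A \<inter> ?B) / prob ?A"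
    unfolding given_start_def by (rule measure_uniform_measure[OF emeasure_start]) measurable
  also have "?A \<inter> ?B = {\<omega> \<in> space M. (\<forall>j\<le>0. Y j \<omega> = (\<lambda>_. x) j) \<and>
      (\<forall>j. 0 < j \<and> j \<le> 0 + k \<longrightarrow> Y j \<omega> \<in> S) \<and> Y (Suc (0 + k)) \<omega> = a}"
    by auto
  finally show ?thesis
    unfolding prob_cylinder_first_passage using start by simp
qed

lemma N_hit_before:
  assumes "a < b"
  shows "measure N {\<omega> \<in> space M. \<tau> a \<omega> = enat k \<and> \<tau> a \<omega> < \<sigma> b \<omega>} =
    (case k of 0 \<Rightarrow> 0 | Suc k \<Rightarrow> first_passage U ({..<b} - {a}) a k x)"
proof (cases k)
  case 0
  then show ?thesis using hit_time_neq_0[unfolded zero_enat_def] by simp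
next
  case (Suc m)
  have "{\<omega> \<in> space M. \<tau> a \<omega> = enat k \<and> \<tau> a \<omega> < \<sigma> b \<omega>} = {\<omega> \<in> space M.
     (\<forall>j. 0 < j \<and> j \<le> m \<longrightarrow> Y j \<omega> \<in> {..<b} - {a}) \<and> Y (Suc m) \<omega> = a}"
    unfolding Suc hit_time_before_iff[OF assms] ..
  then show ?thesis unfolding Suc by (simp only: N_first_passage nat.case)
qed

lemma fps_nth_u_left:
  "fps_nth (u_left_fps M Y a b x) k = measure N {\<omega> \<in> space M. \<tau> a \<omega> = enat k \<and> \<tau> a \<omega> < \<sigma> b \<omega>}"
proof -
  have "fps_nth (u_left_fps M Y a b x) k =
      (LINT \<omega>|N. indicator {\<omega> \<in> space M. \<tau> a \<omega> = enat k \<and> \<tau> a \<omega> < \<sigma> b \<omega>} \<omega>)"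
    unfolding u_left_fps_def fps_expectation_def fps_nth_Abs_fps
  proof (intro Bochner_Integration.integral_cong refl)
    fix \<omega> assume "\<omega> \<in> space N"
    then show "fps_nth (fps_X ^ the_enat (\<tau> a \<omega>) * of_bool (\<tau> a \<omega> < \<sigma> b \<omega>)) k =
        indicat_real {\<omega> \<in> space M. \<tau> a \<omega> = enat k \<and> \<tau> a \<omega> < \<sigma> b \<omega>} \<omega>"
      by (cases "\<tau> a \<omega>") (auto simp: indicator_def fps_X_power_nth)
  qed
  then show ?thesis by (simp add: Int_absorb2 subset_eq)
qed

text \<open>
  The random variable \<open>z\<^sup>\<tau> 1\<^bsub>\<tau><\<sigma>\<^esub>\<close> is a series over the possible values of \<open>\<tau>\<close> with at most
  one nonzero term at each point; the geometric series dominates it and allows integration term by term.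
\<close>

lemma u_left_sums:
  assumes z: "\<bar>z\<bar> < 1"
  shows "(\<lambda>k. z ^ k * measure N {\<omega> \<in> space M. \<tau> a \<omega> = enat k \<and> \<tau> a \<omega> < \<sigma> b \<omega>}) sums u_left M Y a b x z"
proof -
  define H where "H k = {\<omega> \<in> space M. \<tau> a \<omega> = enat k \<and> \<tau> a \<omega> < \<sigma> b \<omega>}" for k
  have H [measurable]: "H k \<in> sets N" for k
    unfolding H_def by measurable
  define f where "f k \<omega> = z ^ k * indicat_real (H k) \<omega>" for k \<omega>
  have f_sums: "(\<lambda>k. f k \<omega>) sums (z ^ the_enat (\<tau> a \<omega>) * of_bool (\<tau> a \<omega> < \<sigma> b \<omega>))"
    if "\<omega> \<in> space M" for \<omega>
  proof (cases "\<tau> a \<omega>")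
    case (enat m)
    then have "(\<lambda>k. f k \<omega>) = (\<lambda>k. if k = m then z ^ m * of_bool (\<tau> a \<omega> < \<sigma> b \<omega>) else 0)"
      using that by (auto simp: f_def H_def indicator_def)
    then show ?thesis using enat sums_single[of m "\<lambda>_. z ^ m * of_bool (\<tau> a \<omega> < \<sigma> b \<omega>)"] by simp
  next
    case infinity
    then have "(\<lambda>k. f k \<omega>) = (\<lambda>k. 0)"
      by (auto simp: f_def H_def indicator_def)
    then show ?thesis using infinity by simp
  qed
  have f_le: "norm (f k \<omega>) \<le> \<bar>z\<bar> ^ k" for k \<omega>
    by (auto simp: f_def power_abs abs_mult indicator_def)
  have int: "integrable N (f k)" for k
  proof (rule N.integrable_const_bound)
    show "AE \<omega> in N. norm (f k \<omega>) \<le> \<bar>z\<bar> ^ k" using f_le by (rule AE_I2)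
    show "f k \<in> borel_measurable N" unfolding f_def by measurable
  qed
  have geom: "summable (\<lambda>k. \<bar>z\<bar> ^ k)" using z by (simp add: summable_geometric)
  have "(\<lambda>k. integral\<^sup>L N (f k)) sums (\<integral>\<omega>. (\<Sum>k. f k \<omega>) \<partial>N)"
  proof (rule sums_integral[OF int])
    show "AE \<omega> in N. summable (\<lambda>k. norm (f k \<omega>))"
      using f_le by (intro AE_I2 summable_comparison_test'[OF geom, of 0]) simp
    show "summable (\<lambda>k. \<integral>\<omega>. norm (f k \<omega>) \<partial>N)"
    proof (rule summable_comparison_test'[OF geom, of 0])
      fix k
      have "(\<integral>\<omega>. norm (f k \<omega>) \<partial>N) \<le> (\<integral>\<omega>. \<bar>z\<bar> ^ k \<partial>N)"
        using int f_le by (intro integral_mono integrable_norm) auto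
      then show "norm (\<integral>\<omega>. norm (f k \<omega>) \<partial>N) \<le> \<bar>z\<bar> ^ k"
        using N.prob_space by simp
    qed
  qed
  also have "(\<integral>\<omega>. (\<Sum>k. f k \<omega>) \<partial>N) = u_left M Y a b x z"
    unfolding u_left_def using f_sums
    by (intro Bochner_Integration.integral_cong) (auto simp: sums_iff)
  finally show ?thesis by (simp add: f_def H_def)
qed

lemma first_passage_total: "(\<lambda>k. first_passage U (- {a}) a k x) sums measure N {\<omega> \<in> space M. \<tau> a \<omega> < \<infinity>}"
proof -
  let ?H = "\<lambda>k. {\<omega> \<in> space M. \<tau> a \<omega> = enat (Suc k)}"
  have "(\<lambda>k. measure N (?H k)) sums measure N (\<Union>k. ?H k)"
    by (intro N.finite_measure_UNION) (auto simp: disjoint_family_on_def)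
  also have "(\<Union>k. ?H k) = {\<omega> \<in> space M. \<tau> a \<omega> < \<infinity>}"
  proof (intro equalityI subsetI)
    fix \<omega> assume "\<omega> \<in> {\<omega> \<in> space M. \<tau> a \<omega> < \<infinity>}"
    moreover from this obtain k where k: "\<tau> a \<omega> = enat k" by auto
    moreover have "k \<noteq> 0" using k hit_time_neq_0[unfolded zero_enat_def] by metis
    ultimately show "\<omega> \<in> (\<Union>k. ?H k)" by (cases k) auto
  qed auto
  also have "(\<lambda>k. measure N (?H k)) = (\<lambda>k. first_passage U (- {a}) a k x)"
    unfolding hit_time_singleton_iff N_first_passage ..
  finally show ?thesis .
qed

text \<open>
  A path that hits \<open>a\<close> at a finite time takes finitely many values until then, so it satisfies
  \<open>\<tau> < \<sigma>\<close> for all large \<open>b\<close>; continuity of the measure along these increasing events.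
\<close>

lemma prob_exceed_before_hit_tendsto_0:
  "(\<lambda>b. measure N {\<omega> \<in> space M. \<tau> a \<omega> < \<infinity>} - measure N {\<omega> \<in> space M. \<tau> a \<omega> < \<sigma> b \<omega>})
    \<longlonglongrightarrow> 0"
proof -
  have "(\<lambda>b. measure N {\<omega> \<in> space M. \<tau> a \<omega> < \<sigma> b \<omega>}) \<longlonglongrightarrow>
      measure N (\<Union>b. {\<omega> \<in> space M. \<tau> a \<omega> < \<sigma> b \<omega>})"
    by (intro N.finite_Lim_measure_incseq)
      (auto simp: incseq_def intro: less_le_trans[OF _ hit_time_atLeast_mono])
  also have "(\<Union>b. {\<omega> \<in> space M. \<tau> a \<omega> < \<sigma> b \<omega>}) = {\<omega> \<in> space M. \<tau> a \<omega> < \<infinity>}"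
  proof (intro equalityI subsetI)
    fix \<omega> assume "\<omega> \<in> {\<omega> \<in> space M. \<tau> a \<omega> < \<infinity>}"
    then show "\<omega> \<in> (\<Union>b. {\<omega> \<in> space M. \<tau> a \<omega> < \<sigma> b \<omega>})"
      using ex_hit_before[of a "\<lambda>n. Y n \<omega>"] by simp
  next
    fix \<omega> assume "\<omega> \<in> (\<Union>b. {\<omega> \<in> space M. \<tau> a \<omega> < \<sigma> b \<omega>})"
    then obtain b where "\<omega> \<in> space M" "\<tau> a \<omega> < \<sigma> b \<omega>" by blast
    then show "\<omega> \<in> {\<omega> \<in> space M. \<tau> a \<omega> < \<infinity>}"
      using hit_time_less_finite[of "{a}" "\<lambda>n. Y n \<omega>" "\<sigma> b \<omega>"] by simp
  qed
  finally show ?thesis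
    using tendsto_diff[OF tendsto_const, of _ _ sequentially "measure N {\<omega> \<in> space M. \<tau> a \<omega> < \<infinity>}"]
    by force
qed

text \<open>
  The bound is the same for all weights \<open>w\<close>. This uniformity yields at once the convergence of
  every coefficient and the uniform convergence in \<open>z\<close>.
\<close>

lemma weighted_hit_before_le:
  fixes w :: "enat \<Rightarrow> real"
  assumes w: "\<And>t. \<bar>w t\<bar> \<le> 1"
  shows "\<bar>(LINT \<omega>|N. w (\<tau> a \<omega>) * of_bool (\<tau> a \<omega> < \<sigma> b \<omega>)) -
          (LINT \<omega>|N. w (\<tau> a \<omega>) * of_bool (\<tau> a \<omega> < \<infinity>))\<bar>
      \<le> measure N {\<omega> \<in> space M. \<tau> a \<omega> < \<infinity>} - measure N {\<omega> \<in> space M. \<tau> a \<omega> < \<sigma> b \<omega>}"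
proof -
  let ?I = "{\<omega> \<in> space M. \<tau> a \<omega> < \<infinity>}" and ?F = "{\<omega> \<in> space M. \<tau> a \<omega> < \<sigma> b \<omega>}"
  have F_I: "?F \<subseteq> ?I"
    by (intro Collect_mono impI, elim conjE, intro conjI) (assumption, erule hit_time_less_finite)
  have w_meas [measurable]: "(\<lambda>\<omega>. w (\<tau> a \<omega>)) \<in> borel_measurable N"
    by measurable
  have int: "integrable N (\<lambda>\<omega>. w (\<tau> a \<omega>) * of_bool (\<tau> a \<omega> < \<sigma> b \<omega>))"
      "integrable N (\<lambda>\<omega>. w (\<tau> a \<omega>) * of_bool (\<tau> a \<omega> < \<infinity>))"
    using w by (auto intro!: N.integrable_const_bound[where B = 1] simp: of_bool_def)
  have "\<bar>(LINT \<omega>|N. w (\<tau> a \<omega>) * of_bool (\<tau> a \<omega> < \<sigma> b \<omega>)) -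
          (LINT \<omega>|N. w (\<tau> a \<omega>) * of_bool (\<tau> a \<omega> < \<infinity>))\<bar> =
     \<bar>LINT \<omega>|N. w (\<tau> a \<omega>) * of_bool (\<tau> a \<omega> < \<sigma> b \<omega>) - w (\<tau> a \<omega>) * of_bool (\<tau> a \<omega> < \<infinity>)\<bar>"
    using int by simp
  also have "\<dots> \<le> (LINT \<omega>|N. \<bar>w (\<tau> a \<omega>) * of_bool (\<tau> a \<omega> < \<sigma> b \<omega>) - w (\<tau> a \<omega>) * of_bool (\<tau> a \<omega> < \<infinity>)\<bar>)"
    by (rule integral_abs_bound)
  also have "\<dots> \<le> (LINT \<omega>|N. indicator (?I - ?F) \<omega>)"
  proof (rule integral_mono)
    show "integrable N (\<lambda>\<omega>. \<bar>w (\<tau> a \<omega>) * of_bool (\<tau> a \<omega> < \<sigma> b \<omega>) - w (\<tau> a \<omega>) * of_bool (\<tau> a \<omega> < \<infinity>)\<bar>)"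
      using int by auto
    show "integrable N (indicat_real (?I - ?F))"
      by (intro integrable_real_indicator) (auto simp: N.emeasure_eq_measure)
    fix \<omega> assume "\<omega> \<in> space N"
    then show "\<bar>w (\<tau> a \<omega>) * of_bool (\<tau> a \<omega> < \<sigma> b \<omega>) - w (\<tau> a \<omega>) * of_bool (\<tau> a \<omega> < \<infinity>)\<bar>
        \<le> indicat_real (?I - ?F) \<omega>"
      using w[of "\<tau> a \<omega>"] F_I by (cases "\<tau> a \<omega> < \<sigma> b \<omega>") (auto simp: indicator_def of_bool_def)
  qed
  also have "\<dots> = measure N (?I - ?F)" by simp
  also have "\<dots> = measure N ?I - measure N ?F"
    using F_I by (intro N.finite_measure_Diff) auto
  finally show ?thesis .
qed

end

section \<open>Determinant formula and convergence\<close>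

text \<open>
  The coefficients of the generating function of the killed hitting time of \<open>a\<close>, except that the
  value at \<open>x = a\<close> is that of the time \<open>0\<close> rather than of the first return time. With this
  boundary value the first-step equation holds in one form for all \<open>k\<close>.
\<close>

definition passage_coeff :: "(nat \<Rightarrow> nat \<Rightarrow> real) \<Rightarrow> nat \<Rightarrow> nat \<Rightarrow> nat \<Rightarrow> nat \<Rightarrow> real" where
  "passage_coeff U a b x k =
     (if x = a then of_bool (k = 0)
      else case k of 0 \<Rightarrow> 0 | Suc k \<Rightarrow> first_passage U ({..<b} - {a}) a k x)"

lemma passage_coeff_Suc:
  assumes "a < b" "x \<noteq> a"
  shows "passage_coeff U a b x (Suc k) = (\<Sum>y<b. U x y * passage_coeff U a b y k)"
proof -
  have split: "(\<Sum>y<b. U x y * passage_coeff U a b y k) = U x a * passage_coeff U a b a k +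
      (\<Sum>y\<in>{..<b} - {a}. U x y * passage_coeff U a b y k)"
    using assms by (intro sum.remove) auto
  show ?thesis
  proof (cases k)
    case 0
    then show ?thesis unfolding split using assms by (simp add: passage_coeff_def)
  next
    case (Suc m)
    have "first_passage U ({..<b} - {a}) a (Suc m) x = (\<Sum>y\<in>{..<b} - {a}.
        U x y * (of_bool (y \<in> {..<b} - {a}) * first_passage U ({..<b} - {a}) a m y))"
      unfolding first_passage.simps by (rule suminf_finite) auto
    also have "\<dots> = (\<Sum>y\<in>{..<b} - {a}. U x y * passage_coeff U a b y k)"
      by (intro sum.cong) (auto simp: passage_coeff_def Suc)
    finally show ?thesis
      unfolding split using assms by (simp add: passage_coeff_def Suc del: first_passage.simps)
  qed
qed

lemma passage_fps_formula:
  assumes aut: "\<And>i j. j + 1 < i \<Longrightarrow> U i j = 0" and ax: "a < x" and xb: "x < b"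
  shows "Abs_fps (passage_coeff U a b x) =
          char_det_fps U (x + 1) (b - 1) / char_det_fps U (a + 1) (b - 1) *
            (\<Prod>j=a+1..x. fps_X * fps_const (U j (j - 1)))"
proof -
  let ?W = "\<lambda>i j. fps_X * fps_const (U i j)"
  let ?v = "\<lambda>y. Abs_fps (passage_coeff U a b y)"
  have b: "b > 0" using xb by simp
  have nonzero: "det (id_minus_block ?W b m) \<noteq> 0" for m
  proof
    assume "det (id_minus_block ?W b m) = 0"
    then have "fps_nth (det (id_minus_block ?W b m)) 0 = 0" by (simp only: fps_zero_nth)
    then show False unfolding det_id_minus_block_fps_nth_0 by simp
  qed
  have unit: "is_unit (det (id_minus_block ?W b m))" for m
    unfolding fps_is_unit_iff det_id_minus_block_fps_nth_0 by simp
  have "det (id_minus_block ?W b (a + 1)) * ?v x =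
         det (id_minus_block ?W b (x + 1)) * (\<Prod>j=a+1..x. ?W j (j - 1)) * ?v a"
  proof (rule hessenberg_exit_formula[OF _ nonzero ax xb])
    show "?v y = (\<Sum>k<b. ?W y k * ?v k)" if "a < y" "y < b" for y
    proof (rule fps_ext)
      fix n
      show "fps_nth (?v y) n = fps_nth (\<Sum>k<b. ?W y k * ?v k) n"
        using that
        by (cases n) (simp_all add: fps_sum_nth mult.assoc passage_coeff_Suc, simp add: passage_coeff_def)
    qed
  qed (simp add: aut)
  moreover have "?v a = 1"
    by (rule fps_ext) (simp add: passage_coeff_def)
  ultimately have eq: "det (id_minus_block ?W b (a + 1)) * ?v x =
      det (id_minus_block ?W b (x + 1)) * (\<Prod>j=a+1..x. ?W j (j - 1))"
    by (simp only: mult_1_right)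
  have "?v x = det (id_minus_block ?W b (a + 1)) * ?v x div det (id_minus_block ?W b (a + 1))"
    by (rule nonzero_mult_div_cancel_left[OF nonzero, symmetric])
  also have "\<dots> = det (id_minus_block ?W b (x + 1)) * (\<Prod>j=a+1..x. ?W j (j - 1)) div
      det (id_minus_block ?W b (a + 1))"
    by (simp only: eq)
  also have "\<dots> = det (id_minus_block ?W b (x + 1)) div det (id_minus_block ?W b (a + 1)) *
      (\<Prod>j=a+1..x. ?W j (j - 1))"
    by (rule dvd_div_mult[symmetric, OF unit_imp_dvd[OF unit]])
  finally show ?thesis
    unfolding char_det_eq[OF b] .
qed

lemma passage_coeff_bounds:
  assumes "transition_matrix U"
  shows "0 \<le> passage_coeff U a b x k" "passage_coeff U a b x k \<le> 1"
  using first_passage_bounds[OF assms] by (auto simp: passage_coeff_def split: nat.split)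

lemma passage_sum_formula:
  assumes U: "transition_matrix U"
    and aut: "\<And>i j. j + 1 < i \<Longrightarrow> U i j = 0" and ax: "a < x" and xb: "x < b" and z: "\<bar>z\<bar> < 1"
  shows "(\<Sum>k. z ^ k * passage_coeff U a b x k) =
          char_det U (x + 1) (b - 1) z / char_det U (a + 1) (b - 1) z *
              (\<Prod>j=a+1..x. z * U j (j - 1))"
proof -
  let ?v = "\<lambda>y. \<Sum>k. z ^ k * passage_coeff U a b y k"
  have b: "b > 0" using xb by simp
  have summable: "summable (\<lambda>k. z ^ k * passage_coeff U a b y k)" for y
  proof (rule summable_comparison_test'[where N = 0])
    show "summable (\<lambda>k. \<bar>z\<bar> ^ k)" using z by (simp add: summable_geometric)
    show "norm (z ^ k * passage_coeff U a b y k) \<le> \<bar>z\<bar> ^ k" for k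
      using passage_coeff_bounds[OF U, of a b y k] by (simp add: abs_mult power_abs mult_left_le)
  qed
  have "det (id_minus_block (\<lambda>i j. z * U i j) b (a + 1)) * ?v x =
         det (id_minus_block (\<lambda>i j. z * U i j) b (x + 1)) * (\<Prod>j=a+1..x. z * U j (j - 1)) * ?v a"
  proof (rule hessenberg_exit_formula[OF _ det_id_minus_block_real_nonzero[OF U z] ax xb])
    fix y assume y: "a < y" "y < b"
    have "?v y = (\<Sum>k. z ^ Suc k * passage_coeff U a b y (Suc k))"
      using suminf_split_head[OF summable[of y]] y by (simp add: passage_coeff_def)
    also have "\<dots> = (\<Sum>k. \<Sum>j<b. z * U y j * (z ^ k * passage_coeff U a b j k))"
      using y by (simp add: passage_coeff_Suc sum_distrib_left mult_ac)
    also have "\<dots> = (\<Sum>j<b. z * U y j * ?v j)"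
      using summable by (simp add: suminf_sum summable_mult suminf_mult del: mult.assoc)
    finally show "?v y = (\<Sum>j<b. z * U y j * ?v j)" .
  qed (simp add: aut)
  moreover have "?v a = 1"
    using suminf_split_head[OF summable[of a]] by (simp add: passage_coeff_def)
  ultimately show ?thesis
    using det_id_minus_block_real_nonzero[OF U z, of b "a + 1"]
    unfolding char_det_eq[OF b] by (simp add: field_simps)
qed

context chain_started_at
begin

lemma N_passage_coeff:
  assumes "a < x" "x < b"
  shows "measure N {\<omega> \<in> space M. \<tau> a \<omega> = enat k \<and> \<tau> a \<omega> < \<sigma> b \<omega>} = passage_coeff U a b x k"
  using N_hit_before[of a b k] assms by (simp add: passage_coeff_def)

lemma u_left_fps_formula:
  assumes aut: "\<And>i j. j + 1 < i \<Longrightarrow> U i j = 0" and "a < x" "x < b"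
  shows "u_left_fps M Y a b x =
          char_det_fps U (x + 1) (b - 1) / char_det_fps U (a + 1) (b - 1) *
            (\<Prod>j=a+1..x. fps_X * fps_const (U j (j - 1)))"
proof -
  have "u_left_fps M Y a b x = Abs_fps (passage_coeff U a b x)"
    using assms(2,3) by (intro fps_ext) (simp add: fps_nth_u_left N_passage_coeff)
  then show ?thesis using passage_fps_formula[OF assms] by simp
qed

lemma u_left_formula:
  assumes aut: "\<And>i j. j + 1 < i \<Longrightarrow> U i j = 0" and "a < x" "x < b" and z: "\<bar>z\<bar> < 1"
  shows "u_left M Y a b x z =
          char_det U (x + 1) (b - 1) z / char_det U (a + 1) (b - 1) z *
            (\<Prod>j=a+1..x. z * U j (j - 1))"
proof -
  have "u_left M Y a b x z = (\<Sum>k. z ^ k * passage_coeff U a b x k)"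
    using u_left_sums[OF z, of a b] assms(2,3) by (simp add: N_passage_coeff sums_iff)
  then show ?thesis using passage_sum_formula[OF U assms] by simp
qed

lemma u_left_fps_tendsto:
  "(\<lambda>b. fps_nth (u_left_fps M Y 0 b x) k) \<longlonglongrightarrow> fps_nth (u_left_infinity_fps M Y x) k"
proof -
  define w :: "enat \<Rightarrow> real" where "w t = of_bool (the_enat t = k)" for t
  have w: "\<bar>w t\<bar> \<le> 1" for t by (simp add: w_def)
  have coeff: "fps_nth (fps_X ^ the_enat t * of_bool c) k = w t * of_bool c" for t c
    by (cases c) (auto simp: w_def fps_X_power_nth)
  have eq: "fps_nth (u_left_fps M Y 0 b x) k = (LINT \<omega>|N. w (\<tau> 0 \<omega>) * of_bool (\<tau> 0 \<omega> < \<sigma> b \<omega>))" for b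
    unfolding u_left_fps_def fps_expectation_def fps_nth_Abs_fps coeff ..
  have eq_inf: "fps_nth (u_left_infinity_fps M Y x) k =
      (LINT \<omega>|N. w (\<tau> 0 \<omega>) * of_bool (\<tau> 0 \<omega> < \<infinity>))"
    unfolding u_left_infinity_fps_def fps_expectation_def fps_nth_Abs_fps coeff ..
  have "(\<lambda>b. fps_nth (u_left_fps M Y 0 b x) k - fps_nth (u_left_infinity_fps M Y x) k) \<longlonglongrightarrow> 0"
    unfolding eq eq_inf
  proof (rule tendsto_0_le[OF prob_exceed_before_hit_tendsto_0[of 0], of _ 1], intro always_eventually allI)
    fix b
    show "norm ((LINT \<omega>|N. w (\<tau> 0 \<omega>) * of_bool (\<tau> 0 \<omega> < \<sigma> b \<omega>)) -
        (LINT \<omega>|N. w (\<tau> 0 \<omega>) * of_bool (\<tau> 0 \<omega> < \<infinity>)))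
      \<le> norm (measure N {\<omega> \<in> space M. \<tau> 0 \<omega> < \<infinity>} -
        measure N {\<omega> \<in> space M. \<tau> 0 \<omega> < \<sigma> b \<omega>}) * 1"
      unfolding real_norm_def mult_1_right
      by (rule order.trans[OF weighted_hit_before_le[where w = w, OF w] abs_ge_self])
  qed
  then show ?thesis by (simp add: LIM_zero_iff)
qed

lemma u_left_uniform_limit:
  assumes K: "K \<subseteq> {0..<1}"
  shows "uniform_limit K (\<lambda>b. u_left M Y 0 b x) (u_left_infinity M Y x) sequentially"
proof (rule uniform_limitI)
  fix e :: real assume "e > 0"
  have "\<forall>\<^sub>F b in sequentially. measure N {\<omega> \<in> space M. \<tau> 0 \<omega> < \<infinity>} -
      measure N {\<omega> \<in> space M. \<tau> 0 \<omega> < \<sigma> b \<omega>} < e"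
    by (rule order_tendstoD(2)[OF prob_exceed_before_hit_tendsto_0 \<open>e > 0\<close>])
  then show "\<forall>\<^sub>F b in sequentially. \<forall>z\<in>K. dist (u_left M Y 0 b x z) (u_left_infinity M Y x z) < e"
  proof eventually_elim
    fix b assume less: "measure N {\<omega> \<in> space M. \<tau> 0 \<omega> < \<infinity>} -
      measure N {\<omega> \<in> space M. \<tau> 0 \<omega> < \<sigma> b \<omega>} < e"
    show "\<forall>z\<in>K. dist (u_left M Y 0 b x z) (u_left_infinity M Y x z) < e"
    proof
      fix z assume "z \<in> K"
      then have "\<bar>z ^ the_enat t\<bar> \<le> 1" for t
        using K by (auto simp: power_abs power_le_one)
      then show "dist (u_left M Y 0 b x z) (u_left_infinity M Y x z) < e"
        unfolding u_left_def u_left_infinity_def dist_real_def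
        by (rule le_less_trans[OF weighted_hit_before_le[of "\<lambda>t. z ^ the_enat t"] less])
    qed
  qed
qed

text \<open>
  Where \<open>\<tau>\<close> is infinite the integrand of \<open>hit_zero_gf\<close> is unspecified, but this happens on a
  null set.
\<close>

lemma hit_zero_gf_eq:
  assumes AE: "AE \<omega> in N. \<tau> 0 \<omega> < \<infinity>"
  shows "hit_zero_gf_fps M Y x = u_left_infinity_fps M Y x" "hit_zero_gf M Y x = u_left_infinity M Y x"
proof -
  have eq: "(LINT \<omega>|N. w (\<tau> 0 \<omega>)) = (LINT \<omega>|N. w (\<tau> 0 \<omega>) * of_bool (\<tau> 0 \<omega> < \<infinity>))" for w :: "enat \<Rightarrow> real"
    by (intro integral_cong_AE) (use AE in \<open>measurable, auto elim!: eventually_mono\<close>)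
  show "hit_zero_gf M Y x = u_left_infinity M Y x"
    unfolding hit_zero_gf_def u_left_infinity_def by (intro ext eq)
  have coeff: "fps_nth (F * of_bool c) k = fps_nth F k * of_bool c" for F :: "real fps" and c k
    by (cases c) auto
  show "hit_zero_gf_fps M Y x = u_left_infinity_fps M Y x"
    unfolding hit_zero_gf_fps_def u_left_infinity_fps_def fps_expectation_def coeff
    by (subst eq[of "\<lambda>t. fps_nth (fps_X ^ the_enat t) _"]) simp
qed

end

section \<open>Recurrence\<close>

text \<open>
  Let \<open>q\<^sub>n x\<close> be the probability, started at \<open>x\<close>, of not hitting \<open>a\<close> during the first \<open>n\<close> steps.
  After a first step to \<open>y \<noteq> a\<close> the hitting has to be avoided for the remaining \<open>n\<close> steps, so
  \<open>U\<^bsub>x,y\<^esub> q\<^sub>n y \<le> q\<^bsub>n+1\<^esub> x\<close>, and \<open>q\<^sub>n x \<rightarrow> 0\<close> forces \<open>q\<^sub>n y \<rightarrow> 0\<close>.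
\<close>

lemma return_from_successor:
  assumes U: "transition_matrix U"
    and from_x: "(\<lambda>k. first_passage U (- {a}) a k x) sums 1"
    and pos: "0 < U x y" and ya: "y \<noteq> a"
  shows "(\<lambda>k. first_passage U (- {a}) a k y) sums 1"
proof -
  let ?h = "first_passage U (- {a}) a"
  define s where "s n y = (\<Sum>k<n. ?h k y)" for n y
  \<comment> \<open>The probability of being at \<open>a\<close> at some time among \<open>0, ..., n\<close>, started at \<open>y\<close>;
    \<open>s\<close> counts only the times \<open>1, ..., n\<close>.\<close>
  define r where "r n y = (if y = a then 1 else s n y)" for n y
  have h_row: "summable (\<lambda>y. U x y * (of_bool (y \<in> - {a}) * ?h k y))" for k x
    using first_passage_bounds[OF U] by (intro summable_row_mult U) (auto simp: of_bool_def)
  have s_Suc: "s (Suc n) x = (\<Sum>y. U x y * r n y)" "summable (\<lambda>y. U x y * r n y)" for n x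
  proof -
    have "(\<lambda>y. if y = a then U x y else 0) sums U x a" by (rule sums_single)
    moreover have "(\<lambda>y. \<Sum>k<n. U x y * (of_bool (y \<in> - {a}) * ?h k y)) sums
        (\<Sum>k<n. ?h (Suc k) x)"
      unfolding first_passage.simps by (intro sums_sum summable_sums h_row)
    ultimately have "(\<lambda>y. (if y = a then U x y else 0) +
        (\<Sum>k<n. U x y * (of_bool (y \<in> - {a}) * ?h k y))) sums (U x a + (\<Sum>k<n. ?h (Suc k) x))"
      by (rule sums_add)
    moreover have "(if y = a then U x y else 0) + (\<Sum>k<n. U x y * (of_bool (y \<in> - {a}) * ?h k y)) =
        U x y * r n y" for y
      by (simp add: r_def s_def sum_distrib_left)
    moreover have "s (Suc n) x = U x a + (\<Sum>k<n. ?h (Suc k) x)"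
      unfolding s_def sum.lessThan_Suc_shift by simp
    ultimately show "s (Suc n) x = (\<Sum>y. U x y * r n y)" "summable (\<lambda>y. U x y * r n y)"
      by (simp_all add: sums_iff)
  qed
  have s_nonneg: "0 \<le> s n y" for n y
    unfolding s_def using first_passage_bounds[OF U] by (intro sum_nonneg) auto
  have s_le: "s n y \<le> 1" for n y
  proof (induction n arbitrary: y)
    case (Suc n)
    show ?case
      unfolding s_Suc using Suc s_nonneg by (intro row_mean_le_1 U) (auto simp: r_def)
  qed (simp add: s_def)
  have step: "U x y * (1 - s n y) \<le> 1 - s (Suc n) x" for n
  proof -
    have row: "summable (\<lambda>y. U x y * (1 - r n y))"
      using s_Suc(2)[of x n] transition_matrix_simps[OF U]
      by (simp add: right_diff_distrib summable_diff)
    have "U x y * (1 - s n y) = (\<Sum>y\<in>{y}. U x y * (1 - r n y))"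
      using ya by (simp add: r_def)
    also have "\<dots> \<le> (\<Sum>y. U x y * (1 - r n y))"
      using row transition_matrix_simps[OF U] s_le by (intro sum_le_suminf) (auto simp: r_def)
    also have "\<dots> = 1 - s (Suc n) x"
      unfolding s_Suc right_diff_distrib using s_Suc(2)[of x n] transition_matrix_simps[OF U]
      by (simp add: suminf_diff[symmetric])
    finally show ?thesis .
  qed
  have "(\<lambda>n. s n x) \<longlonglongrightarrow> 1"
    using from_x unfolding sums_def s_def .
  then have "(\<lambda>n. (1 - s (Suc n) x) / U x y) \<longlonglongrightarrow> (1 - 1) / U x y"
    using pos by (intro tendsto_intros LIMSEQ_Suc) auto
  then have "(\<lambda>n. (1 - s (Suc n) x) / U x y) \<longlonglongrightarrow> 0" by simp
  then have "(\<lambda>n. 1 - s n y) \<longlonglongrightarrow> 0"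
  proof (rule tendsto_sandwich[rotated 3])
    show "\<forall>\<^sub>F n in sequentially. 0 \<le> 1 - s n y" using s_le by simp
    show "\<forall>\<^sub>F n in sequentially. 1 - s n y \<le> (1 - s (Suc n) x) / U x y"
      using step pos by (simp add: field_simps)
  qed auto
  then have "(\<lambda>n. 1 - (1 - s n y)) \<longlonglongrightarrow> 1 - 0" by (intro tendsto_intros)
  then show ?thesis by (simp add: sums_def s_def)
qed

lemma matrix_power_Suc_posE:
  assumes U: "transition_matrix U" and pos: "matrix_power U (Suc n) i j > 0"
  obtains k where "U i k > 0" "matrix_power U n k j > 0"
proof -
  have nonneg: "0 \<le> matrix_power U n k j \<and> matrix_power U n k j \<le> 1" for n k
    by (induction n arbitrary: k) (auto simp: of_bool_def intro!: row_mean_le_1 U)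
  show thesis
  proof (rule ccontr)
    assume "\<not> thesis"
    then have "U i k * matrix_power U n k j = 0" for k
      using that[of k] nonneg[of n k] transition_matrix_simps(1)[OF U, of i k]
      by (metis less_eq_real_def mult_eq_0_iff)
    with pos show False by simp
  qed
qed

lemma return_from_everywhere:
  assumes U: "transition_matrix U" and irr: "irreducible_matrix U"
    and a: "(\<lambda>k. first_passage U (- {a}) a k a) sums 1"
  shows "(\<lambda>k. first_passage U (- {a}) a k x) sums 1"
proof -
  have "(\<lambda>k. first_passage U (- {a}) a k j) sums 1"
    if "matrix_power U n i j > 0" "(\<lambda>k. first_passage U (- {a}) a k i) sums 1" for n i j
    using that
  proof (induction n arbitrary: i)
    case 0
    then show ?case by (simp split: if_splits)
  next
    case (Suc n)
    from Suc.prems(1) obtain k where k: "U i k > 0" "matrix_power U n k j > 0"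
      by (rule matrix_power_Suc_posE[OF U])
    show ?case
    proof (rule Suc.IH[OF k(2)])
      show "(\<lambda>m. first_passage U (- {a}) a m k) sums 1"
        using a return_from_successor[OF U Suc.prems(2) k(1)] by (cases "k = a") auto
    qed
  qed
  moreover obtain n where "matrix_power U n a x > 0"
    using irr by (auto simp: irreducible_matrix_def)
  ultimately show ?thesis using a by blast
qed

context homogeneous_chain
begin

lemma ex_positive_cylinder:
  assumes "matrix_power U n i j > 0" "\<P>(\<omega> in M. \<forall>k\<le>m. Y k \<omega> = p k) > 0" "p m = i"
  shows "\<exists>m' p'. \<P>(\<omega> in M. \<forall>k\<le>m'. Y k \<omega> = p' k) > 0 \<and> p' m' = j"
  using assms
proof (induction n arbitrary: i m p)
  case 0
  then show ?case by (auto split: if_splits)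
next
  case (Suc n)
  from Suc.prems(1) obtain k where k: "U i k > 0" "matrix_power U n k j > 0"
    by (rule matrix_power_Suc_posE[OF U])
  let ?q = "p(Suc m := k)"
  have "{\<omega> \<in> space M. \<forall>l\<le>Suc m. Y l \<omega> = ?q l} =
      {\<omega> \<in> space M. (\<forall>l\<le>m. Y l \<omega> = p l) \<and> Y (Suc m) \<omega> = k}"
    by (auto simp: le_Suc_eq)
  then have "\<P>(\<omega> in M. \<forall>l\<le>Suc m. Y l \<omega> = ?q l) > 0"
    using Suc.prems k by (simp add: prob_cylinder_Suc)
  then show ?case by (rule Suc.IH[OF k(2)]) simp
qed

text \<open>
  Conditioning on the complete past up to time \<open>m\<close>, and not just on \<open>Y\<^sub>m\<close>, keeps every event that
  has to be evaluated a single cylinder, so that no summation over pasts is needed.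
\<close>

definition future_law :: "(nat \<Rightarrow> nat) \<Rightarrow> nat \<Rightarrow> (nat \<Rightarrow> nat) measure" where
  "future_law p m = distr (uniform_measure M {\<omega> \<in> space M. \<forall>k\<le>m. Y k \<omega> = p k})
     (PiM UNIV (\<lambda>_. count_space UNIV)) (\<lambda>\<omega> n. Y (m + n) \<omega>)"

lemma sets_future_law: "sets (future_law p m) = sets (PiM UNIV (\<lambda>_. count_space UNIV))"
  by (simp add: future_law_def)

context
  fixes p :: "nat \<Rightarrow> nat" and m :: nat
  assumes pos: "\<P>(\<omega> in M. \<forall>k\<le>m. Y k \<omega> = p k) > 0"
begin

lemma emeasure_past: "emeasure M {\<omega> \<in> space M. \<forall>k\<le>m. Y k \<omega> = p k} \<noteq> 0"
    "emeasure M {\<omega> \<in> space M. \<forall>k\<le>m. Y k \<omega> = p k} \<noteq> \<infinity>"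
  using pos by (auto simp: emeasure_eq_measure)

lemma measurable_future:
  "(\<lambda>\<omega> n. Y (m + n) \<omega>) \<in>
    measurable (uniform_measure M {\<omega> \<in> space M. \<forall>k\<le>m. Y k \<omega> = p k}) (PiM UNIV (\<lambda>_. count_space UNIV))"
  by (rule measurable_PiM_single') (auto simp: space_PiM)

lemma space_future_law: "space (future_law p m) = UNIV"
  by (simp add: future_law_def space_PiM)

lemma prob_space_future_law: "prob_space (future_law p m)"
  unfolding future_law_def
  by (intro prob_space.prob_space_distr prob_space_uniform_measure emeasure_past measurable_future)

lemma measure_future_law:
  assumes "{w. Q w} \<in> sets (PiM UNIV (\<lambda>_. count_space UNIV))"
  shows "measure (future_law p m) {w \<in> space (future_law p m). Q w} =
    \<P>(\<omega> in M. (\<forall>k\<le>m. Y k \<omega> = p k) \<and> Q (\<lambda>n. Y (m + n) \<omega>)) / \<P>(\<omega> in M. \<forall>k\<le>m. Y k \<omega> = p k)"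
proof -
  let ?A = "{\<omega> \<in> space M. \<forall>k\<le>m. Y k \<omega> = p k}"
  let ?B = "(\<lambda>\<omega> n. Y (m + n) \<omega>) -` {w. Q w} \<inter> space M"
  have B: "?B \<in> sets M"
    using measurable_sets[OF measurable_future assms] by simp
  have "measure (future_law p m) {w \<in> space (future_law p m). Q w} = measure (uniform_measure M ?A) ?B"
    unfolding space_future_law unfolding future_law_def
    by (simp add: measure_distr[OF measurable_future assms])
  also have "\<dots> = prob (?A \<inter> ?B) / prob ?A"
    by (rule measure_uniform_measure[OF emeasure_past B])
  also have "?A \<inter> ?B = {\<omega> \<in> space M. (\<forall>k\<le>m. Y k \<omega> = p k) \<and> Q (\<lambda>n. Y (m + n) \<omega>)}"
    by auto
  finally show ?thesis .
qed

lemma sets_trajectory [measurable]: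
  "(\<lambda>w. w n) \<in> measurable (PiM UNIV (\<lambda>_. count_space (UNIV::nat set))) (count_space UNIV)"
  by (rule measurable_component_singleton) simp

text \<open>
  Gluing a path \<open>q\<close> of the future to the past \<open>p\<close> gives a path \<open>r\<close> of the original chain, and the
  common factor \<open>\<P>(past)\<close> cancels in the conditional probability.
\<close>

lemma markov_chain_future_law: "markov_chain (future_law p m) (\<lambda>n w. w n) U"
  unfolding markov_chain_def
proof (intro conjI allI impI prob_space_future_law)
  show "(\<lambda>w. w n) \<in> measurable (future_law p m) (count_space UNIV)" for n
    by (simp add: measurable_cong_sets[OF sets_future_law refl] sets_trajectory)
next
  fix n q j
  let ?T = "PiM UNIV (\<lambda>_. count_space (UNIV::nat set))"
  let ?P = "\<P>(\<omega> in M. \<forall>k\<le>m. Y k \<omega> = p k)"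
  assume q: "measure (future_law p m) {w \<in> space (future_law p m). \<forall>k\<le>n. w k = q k} > 0"
  have "{w \<in> space ?T. \<forall>k\<le>n. w k = q k} \<in> sets ?T" by measurable
  then have s1: "{w. \<forall>k\<le>n. w k = q k} \<in> sets ?T" by (simp add: space_PiM)
  have "{w \<in> space ?T. w (Suc n) = j \<and> (\<forall>k\<le>n. w k = q k)} \<in> sets ?T" by measurable
  then have s2: "{w. w (Suc n) = j \<and> (\<forall>k\<le>n. w k = q k)} \<in> sets ?T" by (simp add: space_PiM)
  define r where "r k = (if k \<le> m then p k else q (k - m))" for k
  \<comment> \<open>Past and future overlap at time \<open>m\<close>, so a future of positive probability has to start at \<open>p m\<close>.\<close>
  have "{\<omega> \<in> space M. (\<forall>k\<le>m. Y k \<omega> = p k) \<and> (\<forall>k\<le>n. Y (m + k) \<omega> = q k)} \<noteq> {}"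
    using q unfolding measure_future_law[OF s1] by (intro notI) (simp only: measure_empty div_0 less_irrefl)
  then have q0: "q 0 = p m" by fastforce
  have r: "(\<forall>k\<le>m. Y k \<omega> = p k) \<and> (\<forall>k\<le>n. Y (m + k) \<omega> = q k) \<longleftrightarrow> (\<forall>k\<le>m + n. Y k \<omega> = r k)" for \<omega>
  proof safe
    fix k assume *: "\<forall>k\<le>m. Y k \<omega> = p k" "\<forall>k\<le>n. Y (m + k) \<omega> = q k" "k \<le> m + n"
    show "Y k \<omega> = r k"
      using *(1) *(2)[rule_format, of "k - m"] *(3) by (auto simp: r_def)
  next
    fix k assume *: "\<forall>k\<le>m + n. Y k \<omega> = r k" 
    show "Y k \<omega> = p k" if "k \<le> m" using * that by (simp add: r_def)
    show "Y (m + k) \<omega> = q k" if "k \<le> n" using *[rule_format, of "m + k"] that q0 by (cases k) (auto simp: r_def)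
  qed
  have rn: "r (m + n) = q n" using q0 by (cases n) (auto simp: r_def)
  have past: "measure (future_law p m) {w \<in> space (future_law p m). \<forall>k\<le>n. w k = q k} =
      \<P>(\<omega> in M. \<forall>k\<le>m + n. Y k \<omega> = r k) / ?P"
    unfolding measure_future_law[OF s1] r ..
  have step: "measure (future_law p m) {w \<in> space (future_law p m). w (Suc n) = j \<and> (\<forall>k\<le>n. w k = q k)} =
      \<P>(\<omega> in M. (\<forall>k\<le>m + n. Y k \<omega> = r k) \<and> Y (Suc (m + n)) \<omega> = j) / ?P"
    unfolding measure_future_law[OF s2] r[symmetric] by (intro arg_cong2[where f = "(/)"] arg_cong[where f = prob]) auto
  show "\<P>(w in future_law p m. w (Suc n) = j \<bar> \<forall>k\<le>n. w k = q k) = U (q n) j"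
    unfolding cond_prob_def past step prob_cylinder_Suc rn using q pos unfolding past
    by (auto simp: zero_less_divide_iff)
qed

lemma AE_future_law_start: "AE w in future_law p m. w 0 = p m"
proof -
  interpret F: prob_space "future_law p m" by (rule prob_space_future_law)
  let ?T = "PiM UNIV (\<lambda>_. count_space (UNIV::nat set))"
  have "{w \<in> space ?T. w 0 = p m} \<in> sets ?T" by measurable
  then have s: "{w. w 0 = p m} \<in> sets ?T" by (simp add: space_PiM)
  have "{\<omega> \<in> space M. (\<forall>k\<le>m. Y k \<omega> = p k) \<and> Y (m + 0) \<omega> = p m} = {\<omega> \<in> space M. \<forall>k\<le>m. Y k \<omega> = p k}"
    by auto
  then have "measure (future_law p m) {w \<in> space (future_law p m). w 0 = p m} = 1"
    unfolding measure_future_law[OF s] using pos by simp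
  then show ?thesis
    by (subst F.prob_Collect_eq_1[symmetric]) (use s in \<open>simp_all add: space_future_law sets_future_law\<close>)
qed

end

end

text \<open>
  Recurrence is applied to the law of the future after a path of positive probability from \<open>x\<close>
  to \<open>a\<close>, which is a chain started at \<open>a\<close> on the space of trajectories.
\<close>

lemma (in chain_started_at) recurrent_hit_time_finite:
  assumes irr: "irreducible_matrix U" and rec: "recurrent U"
  shows "AE \<omega> in N. \<tau> a \<omega> < \<infinity>"
proof -
  obtain n where n: "matrix_power U n x a > 0"
    using irr by (auto simp: irreducible_matrix_def)
  have "\<P>(\<omega> in M. \<forall>k\<le>0. Y k \<omega> = x) > 0" using start by simp
  from ex_positive_cylinder[OF n this] obtain m p
    where p: "\<P>(\<omega> in M. \<forall>k\<le>m. Y k \<omega> = p k) > 0" "p m = a" by auto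
  let ?F = "future_law p m"
  let ?X = "\<lambda>n (w :: nat \<Rightarrow> nat). w n"
  interpret F: prob_space ?F by (rule prob_space_future_law[OF p(1)])
  have start_F: "AE w in ?F. w 0 = a" using AE_future_law_start[OF p(1)] p(2) by simp
  have chain_F: "markov_chain ?F ?X U" by (rule markov_chain_future_law[OF p(1)])
  have return: "AE w in ?F. hit_time {a} w < \<infinity>"
    using rec start_F chain_F sets_future_law[of p m] unfolding recurrent_def by blast
  interpret F: homogeneous_chain ?F ?X U by unfold_locales (rule chain_F U)+
  have "F.prob {w \<in> space ?F. w 0 = a} = 1"
    using start_F by (subst F.prob_Collect_eq_1) auto
  then interpret F: chain_started_at ?F ?X U a by unfold_locales simp
  have "AE w in F.N. hit_time {a} w < \<infinity>"
    unfolding given_start_def using return by (intro AE_uniform_measureI) (auto elim: eventually_mono)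
  then have "measure F.N {w \<in> space ?F. hit_time {a} w < \<infinity>} = 1"
    using F.N.prob_Collect_eq_1[of "\<lambda>w. hit_time {a} w < \<infinity>"] F.pred_hit_time_finite[of "{a}"] by simp
  then have "(\<lambda>k. first_passage U (- {a}) a k a) sums 1"
    using F.first_passage_total[of a] by simp
  from return_from_everywhere[OF U irr this, of x] have "measure N {\<omega> \<in> space M. \<tau> a \<omega> < \<infinity>} = 1"
    using first_passage_total[of a] sums_unique2 by blast
  then show ?thesis
    using N.prob_Collect_eq_1[of "\<lambda>\<omega>. \<tau> a \<omega> < \<infinity>"] pred_hit_time_finite[of "{a}"] by simp
qed

theorem proposition2p5:
  fixes M :: "'a measure" and Y :: "nat \<Rightarrow> 'a \<Rightarrow> nat" and U :: "nat \<Rightarrow> nat \<Rightarrow> real"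
  assumes "transition_matrix U"
    and "irreducible_matrix U"
    and "almost_upper_triangular U"
    and "markov_chain M Y U"
  shows
    "(\<forall>a x b. a < x \<and> x < b \<and> \<P>(\<omega> in M. Y 0 \<omega> = x) > 0 \<longrightarrow>
        u_left_fps M Y a b x =
          char_det_fps U (x + 1) (b - 1) / char_det_fps U (a + 1) (b - 1) *
            (\<Prod>j=a+1..x. fps_X * fps_const (U j (j - 1))) \<and>
        (\<forall>z. \<bar>z\<bar> < 1 \<longrightarrow>
          u_left M Y a b x z =
            char_det U (x + 1) (b - 1) z / char_det U (a + 1) (b - 1) z *
              (\<Prod>j=a+1..x. z * U j (j - 1)))) \<and>
     (recurrent U \<longrightarrow>
        (\<forall>x\<ge>1. \<P>(\<omega> in M. Y 0 \<omega> = x) > 0 \<longrightarrow>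
          (\<forall>k. (\<lambda>b. fps_nth (u_left_fps M Y 0 b x) k)
                  \<longlonglongrightarrow> fps_nth (hit_zero_gf_fps M Y x) k) \<and>
          (\<forall>K. compact K \<and> K \<subseteq> {0..<1} \<longrightarrow>
            uniform_limit K (\<lambda>b. u_left M Y 0 b x) (hit_zero_gf M Y x) sequentially))) \<and>
     (\<not> recurrent U \<longrightarrow>
        (\<forall>x\<ge>1. \<P>(\<omega> in M. Y 0 \<omega> = x) > 0 \<longrightarrow>
          (\<forall>k. (\<lambda>b. fps_nth (u_left_fps M Y 0 b x) k)
                  \<longlonglongrightarrow> fps_nth (u_left_infinity_fps M Y x) k) \<and>
          (\<forall>K. compact K \<and> K \<subseteq> {0..<1} \<longrightarrow>
            uniform_limit K (\<lambda>b. u_left M Y 0 b x) (u_left_infinity M Y x) sequentially)))"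
proof -
  have started: "chain_started_at M Y U x" if "\<P>(\<omega> in M. Y 0 \<omega> = x) > 0" for x
    using that assms(1,4)
    by (simp add: chain_started_at_def chain_started_at_axioms_def homogeneous_chain_def
        homogeneous_chain_axioms_def markov_chain_def)
  have aut: "U i j = 0" if "j + 1 < i" for i j
  proof -
    have "\<not> U i j > 0" using assms(3) that by (force simp: almost_upper_triangular_def)
    then show ?thesis using transition_matrix_simps(1)[OF assms(1), of i j] by simp
  qed
  show ?thesis
  proof (intro conjI allI impI; (elim conjE)?)
    fix a x b assume "a < x" "x < b" "\<P>(\<omega> in M. Y 0 \<omega> = x) > 0"
    then show "u_left_fps M Y a b x =
          char_det_fps U (x + 1) (b - 1) / char_det_fps U (a + 1) (b - 1) *
            (\<Prod>j=a+1..x. fps_X * fps_const (U j (j - 1)))"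
      using chain_started_at.u_left_fps_formula[OF started] aut by blast
  next
    fix a x b and z :: real
    assume "a < x" "x < b" "\<P>(\<omega> in M. Y 0 \<omega> = x) > 0" "\<bar>z\<bar> < 1"
    then show "u_left M Y a b x z =
            char_det U (x + 1) (b - 1) z / char_det U (a + 1) (b - 1) z *
              (\<Prod>j=a+1..x. z * U j (j - 1))"
      using chain_started_at.u_left_formula[OF started] aut by blast
  next
    fix x k assume rec: "recurrent U" and start: "\<P>(\<omega> in M. Y 0 \<omega> = x) > 0"
    interpret chain_started_at M Y U x by (rule started[OF start])
    show "(\<lambda>b. fps_nth (u_left_fps M Y 0 b x) k) \<longlonglongrightarrow> fps_nth (hit_zero_gf_fps M Y x) k"
      unfolding hit_zero_gf_eq[OF recurrent_hit_time_finite[OF assms(2) rec]] by (rule u_left_fps_tendsto)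
  next
    fix x K assume rec: "recurrent U" and start: "\<P>(\<omega> in M. Y 0 \<omega> = x) > 0" and K: "K \<subseteq> {0..<1::real}"
    interpret chain_started_at M Y U x by (rule started[OF start])
    show "uniform_limit K (\<lambda>b. u_left M Y 0 b x) (hit_zero_gf M Y x) sequentially"
      unfolding hit_zero_gf_eq[OF recurrent_hit_time_finite[OF assms(2) rec]] by (rule u_left_uniform_limit[OF K])
  next
    fix x k assume start: "\<P>(\<omega> in M. Y 0 \<omega> = x) > 0"
    show "(\<lambda>b. fps_nth (u_left_fps M Y 0 b x) k) \<longlonglongrightarrow> fps_nth (u_left_infinity_fps M Y x) k"
      by (rule chain_started_at.u_left_fps_tendsto[OF started[OF start]])
  next
    fix x K assume start: "\<P>(\<omega> in M. Y 0 \<omega> = x) > 0" and K: "K \<subseteq> {0..<1::real}"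
    show "uniform_limit K (\<lambda>b. u_left M Y 0 b x) (u_left_infinity M Y x) sequentially"
      by (rule chain_started_at.u_left_uniform_limit[OF started[OF start] K])
  qed
qed

end
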